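(* Fix $\epsilon,\eta>0$. In the subgaussian mixture setting described in the context, there exist universal constants $C,c_1,c_2,c_3$ such that if $$\alpha=\frac{n_{\max}}{n_{\min}}\lesssim k\lesssim m\qquad\text{and}\qquad N>\max\{c_1 m,\ c_2\log(2/\eta),\ \log(c_3/\eta)\},$$ then $$\|X_D-X_R\|_{\mathrm F}^2\le \epsilon$$ with probability at least $1-2\eta$, provided $$\Delta_{\min}^2\ \ge\ \frac{C}{\epsilon}\,k^2\,\alpha\,\sigma_{\max}^2 ,$$ where $\Delta_{\min}=\min_{a\ne b}\|\gamma_a-\gamma_b\|_2$ is the minimal cluster center separation.
   Context: Setting. For each $t\in\{1,\dots,k\}$, $\mathcal D_t$ is a subgaussian probability distribution on $\mathbb R^m$ with first moment (mean) $\gamma_t\in\mathbb R^m$ and second moment matrix (of the centered vector $x-\gamma_t$, $x\sim\mathcal D_t$) with largest eigenvalue $\sigma_t^2$. For each $t$, $n_t$ points $\{x_{t,i}\}_{i=1}^{n_t}$ are drawn independently from $\mathcal D_t$. Put $N=\sum_{t=1}^k n_t$, $n_{\min}=\min_t n_t$, $n_{\max}=\max_t n_t$, $\sigma_{\max}=\max_t\sigma_t$. The notation $A\lesssim B$ means $A\le cB$ for some absolute constant $c>0$. Let $D$ be the $N\times N$ matrix of squared Euclidean distances between the points, $D_{ij}=\|x_i-x_j\|_2^2$ (indices $i,j$ running over all $N$ points). $X_D$ denotes the minimizer of the $k$-means semidefinite program $$\text{minimize } \operatorname{Tr}(DX)\quad\text{subject to}\quad \operatorname{Tr}(X)=k,\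 X1=1,\ X\ge0 \text{ (entrywise)},\ X\succeq0 \text{ (symmetric positive semidefinite)},$$ where $1$ is the all-ones vector. $X_R:=\sum_{t=1}^k\frac1{n_t}1_t1_t^\top$, where $1_t\in\mathbb R^N$ is the indicator vector of the indices of the points drawn from $\mathcal D_t$. $\|\cdot\|_{\mathrm F}$ is the Frobenius norm.
   Formalization: The constants may depend on a bound K for the ratio of the subgaussian (psi_2) norms to sigma_max, since with no such bound rare far outliers refute the claim; the centers are also assumed distinct, which matters only when sigma_max = 0. *)

theory Defs
  imports "HOL-Probability.Probability" "Jordan_Normal_Form.Spectral_Radius"
begin

(* The dimension m varies below the existential quantifier over the constants, so R^m cannot be a
   type indexed by m: its points are the elements of space (Rn m), i.e. functions nat => real
   that are undefined outside {..<m}. *)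

type_synonym point = "nat \<Rightarrow> real"

abbreviation Rn :: "nat \<Rightarrow> point measure" where
  "Rn m \<equiv> PiM {..<m} (\<lambda>_. borel)"

definition eucl_dist :: "nat \<Rightarrow> point \<Rightarrow> point \<Rightarrow> real" where
  "eucl_dist m x y = L2_set (\<lambda>j. x j - y j) {..<m}"

definition mean_point :: "nat \<Rightarrow> point measure \<Rightarrow> point" where
  "mean_point m P = (\<lambda>j\<in>{..<m}. \<integral>x. x j \<partial>P)"

definition covariance_mat :: "nat \<Rightarrow> point measure \<Rightarrow> real mat" where
  "covariance_mat m P =
     Matrix.mat m m (\<lambda>(i, j). \<integral>x. (x i - mean_point m P i) * (x j - mean_point m P j) \<partial>P)"

definition sigma :: "nat \<Rightarrow> point measure \<Rightarrow> real" where
  "sigma m P = sqrt (Max (spectrum (covariance_mat m P)))"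

(* The Orlicz psi_2 norm of a real random variable; it is \<infinity> if no scale s is admissible. *)
definition psi2_norm :: "'a measure \<Rightarrow> ('a \<Rightarrow> real) \<Rightarrow> ennreal" where
  "psi2_norm P f =
     Inf {ennreal s | s. s > 0 \<and> (\<integral>\<^sup>+ x. ennreal (exp ((f x / s)\<^sup>2)) \<partial>P) \<le> 2}"

(* The psi_2 norm of the centered random vector: the supremum over all one-dimensional
   marginals in unit directions u. It scales like sigma, so constants that are uniform over a family
   of subgaussian distributions depend on a bound for its ratio to the standard deviation. *)
definition subgaussian_norm :: "nat \<Rightarrow> point measure \<Rightarrow> ennreal" where
  "subgaussian_norm m P =
     (SUP u \<in> {u. L2_set u {..<m} = 1}. psi2_norm P (\<lambda>x. \<Sum>j<m. u j * (x j - mean_point m P j)))"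

definition subgaussian_distribution :: "nat \<Rightarrow> point measure \<Rightarrow> bool" where
  "subgaussian_distribution m P \<longleftrightarrow>
     prob_space P \<and> sets P = sets (Rn m) \<and> subgaussian_norm m P < \<infinity>"

(* The N sample points are numbered 0, ..., N - 1 in any order; lab i is the index of the
   distribution from which point i is drawn, and components are numbered 0, ..., k - 1. *)

definition cluster_size :: "nat \<Rightarrow> (nat \<Rightarrow> nat) \<Rightarrow> nat \<Rightarrow> nat" where
  "cluster_size N lab t = card {i. i < N \<and> lab i = t}"

definition n_min :: "nat \<Rightarrow> nat \<Rightarrow> (nat \<Rightarrow> nat) \<Rightarrow> nat" where
  "n_min k N lab = Min (cluster_size N lab ` {..<k})"

definition n_max :: "nat \<Rightarrow> nat \<Rightarrow> (nat \<Rightarrow> nat) \<Rightarrow> nat" where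
  "n_max k N lab = Max (cluster_size N lab ` {..<k})"

definition imbalance :: "nat \<Rightarrow> nat \<Rightarrow> (nat \<Rightarrow> nat) \<Rightarrow> real" where
  "imbalance k N lab = real (n_max k N lab) / real (n_min k N lab)"

definition sigma_max :: "nat \<Rightarrow> nat \<Rightarrow> (nat \<Rightarrow> point measure) \<Rightarrow> real" where
  "sigma_max m k P = Max ((\<lambda>t. sigma m (P t)) ` {..<k})"

(* For k = 1 this is the minimum of the empty set, an unspecified real number. *)
definition delta_min :: "nat \<Rightarrow> nat \<Rightarrow> (nat \<Rightarrow> point measure) \<Rightarrow> real" where
  "delta_min m k P =
     Min {eucl_dist m (mean_point m (P a)) (mean_point m (P b)) | a b. a < k \<and> b < k \<and> a \<noteq> b}"

(* The component means are required to be distinct. This matters only if all components are point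
   masses: if two of these coincide, the semidefinite program does not determine the clusters and
   has several minimizers. *)
definition subgaussian_mixture ::
    "nat \<Rightarrow> nat \<Rightarrow> nat \<Rightarrow> (nat \<Rightarrow> nat) \<Rightarrow> (nat \<Rightarrow> point measure) \<Rightarrow> bool" where
  "subgaussian_mixture m k N lab P \<longleftrightarrow>
     k \<ge> 1 \<and>
     (\<forall>i<N. lab i < k) \<and>
     (\<forall>t<k. cluster_size N lab t \<ge> 1) \<and>
     (\<forall>t<k. subgaussian_distribution m (P t)) \<and>
     inj_on (\<lambda>t. mean_point m (P t)) {..<k}"

(* The joint law of the N independent sample points. *)
definition sample :: "nat \<Rightarrow> (nat \<Rightarrow> nat) \<Rightarrow> (nat \<Rightarrow> point measure) \<Rightarrow> (nat \<Rightarrow> point) measure" where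
  "sample N lab P = PiM {..<N} (\<lambda>i. P (lab i))"

definition dist_mat :: "nat \<Rightarrow> nat \<Rightarrow> (nat \<Rightarrow> point) \<Rightarrow> real mat" where
  "dist_mat m N x = Matrix.mat N N (\<lambda>(i, j). (eucl_dist m (x i) (x j))\<^sup>2)"

definition mat_trace :: "real mat \<Rightarrow> real" where
  "mat_trace A = (\<Sum>i<dim_row A. A $$ (i, i))"

definition frobenius_norm :: "real mat \<Rightarrow> real" where
  "frobenius_norm A = sqrt (\<Sum>i<dim_row A. \<Sum>j<dim_col A. (A $$ (i, j))\<^sup>2)"

definition pos_semidef :: "nat \<Rightarrow> real mat \<Rightarrow> bool" where
  "pos_semidef N X \<longleftrightarrow>
     X \<in> carrier_mat N N \<and> transpose_mat X = X \<and>
     (\<forall>v\<in>carrier_vec N. scalar_prod v (mult_mat_vec X v) \<ge> 0)"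

definition sdp_feasible :: "nat \<Rightarrow> nat \<Rightarrow> real mat \<Rightarrow> bool" where
  "sdp_feasible k N X \<longleftrightarrow>
     X \<in> carrier_mat N N \<and>
     mat_trace X = real k \<and>
     mult_mat_vec X (Matrix.vec N (\<lambda>_. 1)) = Matrix.vec N (\<lambda>_. 1) \<and>
     (\<forall>i<N. \<forall>j<N. X $$ (i, j) \<ge> 0) \<and>
     pos_semidef N X"

definition sdp_minimizer :: "nat \<Rightarrow> nat \<Rightarrow> real mat \<Rightarrow> real mat \<Rightarrow> bool" where
  "sdp_minimizer k N D X \<longleftrightarrow>
     sdp_feasible k N X \<and>
     (\<forall>Y. sdp_feasible k N Y \<longrightarrow> mat_trace (D * X) \<le> mat_trace (D * Y))"

definition X_ref :: "nat \<Rightarrow> nat \<Rightarrow> (nat \<Rightarrow> nat) \<Rightarrow> real mat" where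
  "X_ref k N lab = Matrix.mat N N (\<lambda>(i, j).
     \<Sum>t<k. 1 / real (cluster_size N lab t) * of_bool (lab i = t) * of_bool (lab j = t))"

end

(* Write x_i = gamma_i + z_i with gamma_i the mean of the component of x_i, and let L bound the
   squared operator norm of the noise matrix z. For a row-stochastic X the objective is
   sum_ij X_ij |x_i - x_j|^2, a Dirichlet form. Comparing the minimizer X with the reference solution,
   for which the centers contribute nothing, gives
     A <= |cross term| + kL,   A = 1/2 sum_ij X_ij |gamma_i - gamma_j|^2,
   since tr X = k. The centers span a space of dimension at most k, so Cauchy-Schwarz and AM-GM
   along an orthonormal basis of that space bound the cross term by A/2 + 2kL. Thus A <= 6kL, and
   the mass that X puts outside the diagonal blocks is at most 12kL / Delta_min^2. Because
   tr X = k forces |X|_F^2 <= k, that mass divided by n_min controls |X - X_R|_F^2.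
   The bound L of order N sigma_max^2 K^2 comes from a net of the unit ball and the Chernoff bound
   based on E exp(<z,u>^2/s^2) <= 2. *)
theory Submission
  imports Defs
begin

subsection \<open>Linear algebra\<close>

text \<open>The noise energy sum_i |z_i|^2 can collect up to L from each of m directions, so it
  cannot be bounded by a multiple of kL; it has to cancel. For a symmetric stochastic X the
  Dirichlet form is |f|^2 - f^T X f, so the same energy occurs for the minimizer and for the
  reference. What remains of the minimizer is Tr(X z z^T), at most L Tr X because X is a sum of
  rank-one terms y y^T; what remains of the reference has a favourable sign and is dropped. The same
  obstacle shapes the cross term: coordinate by coordinate it would cost L for each of m
  coordinates, whereas along the span of the centers it costs L for each of at most k directions.
  Division by sigma or Delta_min is postponed to the very end, because point masses have sigma = 0
  and Delta_min is unspecified for k = 1.\<close>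

definition dot :: "nat \<Rightarrow> (nat \<Rightarrow> real) \<Rightarrow> (nat \<Rightarrow> real) \<Rightarrow> real" where
  "dot m u v = (\<Sum>l<m. u l * v l)"

lemma dot_commute: "dot m u v = dot m v u"
  by (simp add: dot_def mult.commute)

text \<open>Cholesky factorization by induction: the last row and column are eliminated, and the
  Schur complement \<open>X'\<close> is again symmetric and positive semidefinite.\<close>

lemma psd_factorization:
  fixes X :: "nat \<Rightarrow> nat \<Rightarrow> real"
  assumes "\<And>i j. i < n \<Longrightarrow> j < n \<Longrightarrow> X i j = X j i"
    and "\<And>v. 0 \<le> (\<Sum>i<n. \<Sum>j<n. v i * X i j * v j)"
  shows "\<exists>y. \<forall>i<n. \<forall>j<n. X i j = (\<Sum>s<n. y s i * y s j)"
  using assms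
proof (induction n arbitrary: X)
  case 0
  then show ?case by simp
next
  case (Suc n)
  define d where "d = X n n"
  have expand: "(\<Sum>i<Suc n. \<Sum>j<Suc n. v i * X i j * v j) =
      (\<Sum>i<n. \<Sum>j<n. v i * X i j * v j) + 2 * v n * (\<Sum>i<n. v i * X i n) + (v n)\<^sup>2 * d" for v
  proof -
    have "(\<Sum>j<n. v n * X n j * v j) = v n * (\<Sum>i<n. v i * X i n)"
      unfolding sum_distrib_left by (rule sum.cong) (auto simp: Suc.prems(1)[of n])
    moreover have "(\<Sum>i<n. v i * X i n * v n) = v n * (\<Sum>i<n. v i * X i n)"
      unfolding sum_distrib_left by (rule sum.cong) auto
    ultimately show ?thesis
      by (simp add: sum.distrib d_def power2_eq_square)
  qed
  have quad: "0 \<le> (\<Sum>i<n. \<Sum>j<n. v i * X i j * v j) + 2 * c * (\<Sum>i<n. v i * X i n) + c\<^sup>2 * d" for v c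
  proof -
    have "(\<Sum>i<n. \<Sum>j<n. (v(n := c)) i * X i j * (v(n := c)) j) = (\<Sum>i<n. \<Sum>j<n. v i * X i j * v j)"
      "(\<Sum>i<n. (v(n := c)) i * X i n) = (\<Sum>i<n. v i * X i n)"
      by (auto intro!: sum.cong)
    then show ?thesis
      using Suc.prems(2)[of "v(n := c)"] expand[of "v(n := c)"] by simp
  qed
  have d0: "d \<ge> 0"
    using quad[of "\<lambda>_. 0" 1] by simp
  \<comment> \<open>A zero pivot forces its whole column to vanish; otherwise the form would be
    affine and nonconstant in \<open>c\<close>, hence negative somewhere.\<close>
  have deg: "X i n = 0" if "d = 0" "i < n" for i
  proof (rule ccontr)
    assume ne: "X i n \<noteq> 0"
    define v :: "nat \<Rightarrow> real" where "v = (\<lambda>j. if j = i then 1 else 0)"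
    have "(\<Sum>a<n. \<Sum>b<n. v a * X a b * v b) = X i i" "(\<Sum>a<n. v a * X a n) = X i n"
      using that by (simp_all add: v_def mult_delta_left mult_delta_right)
    \<comment> \<open>The coefficient is chosen so that the right-hand side equals -1.\<close>
    then have "0 \<le> X i i + 2 * (- (X i i + 1) / (2 * X i n)) * X i n"
      using quad[of v "- (X i i + 1) / (2 * X i n)"] \<open>d = 0\<close> by simp
    then show False
      using ne by (simp add: field_simps)
  qed
  \<comment> \<open>Division by zero yields 0, so \<open>X'\<close> is just \<open>X\<close> if the
    pivot is 0; by \<open>deg\<close> nothing has to be eliminated then.\<close>
  define X' where "X' = (\<lambda>i j. X i j - X i n * X j n / d)"
  have "0 \<le> (\<Sum>i<n. \<Sum>j<n. v i * X' i j * v j)" for v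
  proof -
    define b where "b = (\<Sum>i<n. v i * X i n)"
    have "(\<Sum>i<n. \<Sum>j<n. v i * X' i j * v j) =
        (\<Sum>i<n. \<Sum>j<n. v i * X i j * v j) - (\<Sum>i<n. \<Sum>j<n. (v i * X i n) * (v j * X j n)) / d"
      by (simp add: X'_def sum_subtractf[symmetric] sum_divide_distrib algebra_simps diff_divide_distrib)
    also have "(\<Sum>i<n. \<Sum>j<n. (v i * X i n) * (v j * X j n)) = b\<^sup>2"
      by (simp add: b_def power2_eq_square sum_product)
    also have "(\<Sum>i<n. \<Sum>j<n. v i * X i j * v j) - b\<^sup>2 / d =
        (\<Sum>i<n. \<Sum>j<n. v i * X i j * v j) + 2 * (- b / d) * b + (- b / d)\<^sup>2 * d"
      by (cases "d = 0") (auto simp: power2_eq_square field_simps)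
    \<comment> \<open>The value \<open>- b / d\<close> minimizes the quadratic in the last
      coordinate, and the minimum is the form of the Schur complement.\<close>
    also have "\<dots> \<ge> 0"
      using quad[of v "- b / d"] unfolding b_def .
    finally show ?thesis .
  qed
  moreover have "X' i j = X' j i" if "i < n" "j < n" for i j
    using that Suc.prems(1)[of i j] by (simp add: X'_def)
  ultimately obtain y where y: "\<forall>i<n. \<forall>j<n. X' i j = (\<Sum>s<n. y s i * y s j)"
    using Suc.IH[of X'] by blast
  \<comment> \<open>The old vectors are extended by 0 in the new coordinate; the new vector is the
    last column divided by the root of the pivot.\<close>
  define y' where "y' = (\<lambda>s i. if s < n then if i < n then y s i else 0 else X i n / sqrt d)"
  have "X i j = (\<Sum>s<Suc n. y' s i * y' s j)" if "i < Suc n" "j < Suc n" for i j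
  proof -
    have last: "y' n i * y' n j = X i n * X j n / d"
      using d0 by (simp add: y'_def)
    consider "i < n" "j < n" | "i = n" | "j = n"
      using \<open>i < Suc n\<close> \<open>j < Suc n\<close> by linarith
    then show ?thesis
    proof cases
      case 1
      then have "(\<Sum>s<n. y' s i * y' s j) = X' i j"
        using y by (simp add: y'_def)
      then show ?thesis
        by (simp add: last X'_def)
    next
      case 2
      then have "(\<Sum>s<n. y' s i * y' s j) = 0"
        by (simp add: y'_def)
      moreover have "d * X j n / d = X n j"
        using deg[of j] Suc.prems(1)[of n j] d0 that by (cases "d = 0"; cases "j = n") (auto simp: d_def)
      ultimately show ?thesis
        using 2 last by (simp add: d_def)
    next
      case 3
      then have "(\<Sum>s<n. y' s i * y' s j) = 0"
        by (simp add: y'_def)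
      moreover have "X i n * d / d = X i n"
        using deg[of i] d0 that by (cases "d = 0"; cases "i = n") (auto simp: d_def)
      ultimately show ?thesis
        using 3 last by (simp add: d_def)
    qed
  qed
  then show ?case
    by blast
qed

text \<open>Gram-Schmidt: the residual \<open>h\<close> of each further vector either vanishes or is
  normalized and appended. The bound by \<open>k\<close>, whatever \<open>m\<close> is, puts k
  instead of m into the cross term.\<close>

lemma span_orthonormal_basis:
  fixes g :: "nat \<Rightarrow> nat \<Rightarrow> real"
  shows "\<exists>u r. r \<le> k \<and> (\<forall>s<r. \<forall>s'<r. dot m (u s) (u s') = of_bool (s = s')) \<and>
    (\<forall>t<k. \<forall>l<m. g t l = (\<Sum>s<r. dot m (g t) (u s) * u s l))"
proof (induction k)
  case 0
  show ?case by (rule exI, rule exI[of _ 0]) simp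
next
  case (Suc k)
  then obtain u r where r: "r \<le> k"
    and on: "\<And>s s'. s < r \<Longrightarrow> s' < r \<Longrightarrow> dot m (u s) (u s') = of_bool (s = s')"
    and rep: "\<And>t l. t < k \<Longrightarrow> l < m \<Longrightarrow> g t l = (\<Sum>s<r. dot m (g t) (u s) * u s l)"
    by blast
  define h where "h = (\<lambda>l. g k l - (\<Sum>s<r. dot m (g k) (u s) * u s l))"
  have span_dot: "dot m (\<lambda>l. \<Sum>s<r. c s * u s l) v = (\<Sum>s<r. c s * dot m (u s) v)" for c v
    by (simp add: dot_def sum_distrib_right sum_distrib_left mult.assoc sum.swap[of _ "{..<m}"])
  have h_u: "dot m h (u s) = 0" if "s < r" for s
  proof -
    have "dot m h (u s) = dot m (g k) (u s) - dot m (\<lambda>l. \<Sum>s<r. dot m (g k) (u s) * u s l) (u s)"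
      by (simp add: dot_def h_def left_diff_distrib sum_subtractf)
    also have "\<dots> = 0"
      using that by (simp add: span_dot on of_bool_def mult_delta_right)
    finally show ?thesis .
  qed
  have h_g: "dot m (g t) h = 0" if "t < k" for t
  proof -
    have "dot m (g t) h = dot m (\<lambda>l. \<Sum>s<r. dot m (g t) (u s) * u s l) h"
      unfolding dot_def[of m _ h] by (rule sum.cong) (simp_all add: rep[OF that, symmetric])
    also have "\<dots> = 0"
      using h_u by (simp add: span_dot dot_commute[of m "u _" h])
    finally show ?thesis .
  qed
  have h_gk: "dot m (g k) h = dot m h h"
  proof -
    have "dot m h h = dot m (g k) h - dot m (\<lambda>l. \<Sum>s<r. dot m (g k) (u s) * u s l) h"
      by (subst h_def) (simp add: dot_def left_diff_distrib sum_subtractf)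
    also have "dot m (\<lambda>l. \<Sum>s<r. dot m (g k) (u s) * u s l) h = 0"
      using h_u by (simp add: span_dot dot_commute[of m "u _" h])
    finally show ?thesis by simp
  qed
  show ?case
  proof (cases "dot m h h = 0")
    case True
    then have "\<forall>l\<in>{..<m}. h l * h l = 0"
      unfolding dot_def by (subst (asm) sum_nonneg_eq_0_iff) auto
    then have "g k l = (\<Sum>s<r. dot m (g k) (u s) * u s l)" if "l < m" for l
      using that by (auto simp: h_def)
    then show ?thesis
      using r on rep by (intro exI[of _ u] exI[of _ r]) (auto simp: less_Suc_eq)
  next
    case False
    define c where "c = sqrt (dot m h h)"
    have "dot m h h \<ge> 0"
      unfolding dot_def by (simp add: sum_nonneg)
    then have c: "c > 0" "c * c = dot m h h"
      using False by (auto simp: c_def)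
    define u' where "u' = u(r := (\<lambda>l. h l / c))"
    have sc: "dot m v (\<lambda>l. h l / c) = dot m v h / c" "dot m (\<lambda>l. h l / c) v = dot m h v / c" for v
      by (simp_all add: dot_def sum_divide_distrib)
    have on': "dot m (u' s) (u' s') = of_bool (s = s')" if "s < Suc r" "s' < Suc r" for s s'
    proof -
      have "dot m (u p) (\<lambda>l. h l / c) = 0" "dot m (\<lambda>l. h l / c) (u p) = 0" if "p < r" for p
        using h_u[OF that] by (simp_all add: sc dot_commute[of m "u p" h])
      moreover have "dot m (\<lambda>l. h l / c) (\<lambda>l. h l / c) = 1"
        using c by (simp add: sc flip: c(2))
      ultimately show ?thesis
        using that on[of s s'] by (cases "s = r"; cases "s' = r") (simp_all add: u'_def)
    qed
    have rep': "g t l = (\<Sum>s<Suc r. dot m (g t) (u' s) * u' s l)" if "t < Suc k" "l < m" for t l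
    proof -
      have *: "(\<Sum>s<r. dot m (g t) (u' s) * u' s l) = (\<Sum>s<r. dot m (g t) (u s) * u s l)"
        by (simp add: u'_def)
      show ?thesis
      proof (cases "t = k")
        case True
        have "dot m (g k) (\<lambda>l. h l / c) * (h l / c) = h l"
          using c by (simp add: sc h_gk flip: c(2))
        moreover have "g k l = (\<Sum>s<r. dot m (g k) (u s) * u s l) + h l"
          by (simp add: h_def)
        ultimately show ?thesis
          using True * by (simp add: u'_def)
      next
        case False
        then show ?thesis
          using that rep[of t l] h_g[of t] by (simp add: * u'_def sc)
      qed
    qed
    show ?thesis
      using r on' rep' by (intro exI[of _ u'] exI[of _ "Suc r"]) auto
  qed
qed

subsection \<open>Dirichlet forms of stochastic positive semidefinite matrices\<close>

text \<open>The factor 1/2 offsets the double count of pairs: for a symmetric stochastic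
  \<open>X\<close> this is the bilinear form of I - X.\<close>

definition dirichlet :: "nat \<Rightarrow> (nat \<Rightarrow> nat \<Rightarrow> real) \<Rightarrow> (nat \<Rightarrow> real) \<Rightarrow> (nat \<Rightarrow> real) \<Rightarrow> real" where
  "dirichlet N X f g = (\<Sum>i<N. \<Sum>j<N. X i j * ((f i - f j) * (g i - g j))) / 2"

text \<open>The constraints of the semidefinite program other than the trace, for a matrix given as
  a function of two indices. Minimizer and reference are both instances.\<close>

locale stochastic_psd =
  fixes N :: nat and X :: "nat \<Rightarrow> nat \<Rightarrow> real"
  assumes sym: "\<And>i j. i < N \<Longrightarrow> j < N \<Longrightarrow> X i j = X j i"
    and psd: "\<And>v. 0 \<le> (\<Sum>i<N. \<Sum>j<N. v i * X i j * v j)"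
    and row_sum: "\<And>i. i < N \<Longrightarrow> (\<Sum>j<N. X i j) = 1"
    and nonneg: "\<And>i j. i < N \<Longrightarrow> j < N \<Longrightarrow> X i j \<ge> 0"
begin

lemma col_sum: "j < N \<Longrightarrow> (\<Sum>i<N. X i j) = 1"
  using row_sum[of j] sum.cong[of "{..<N}" "{..<N}" "\<lambda>i. X i j" "X j"] sym[of _ j] by simp

lemma dirichlet_self:
  "dirichlet N X f f = (\<Sum>i<N. (f i)\<^sup>2) - (\<Sum>i<N. \<Sum>j<N. X i j * (f i * f j))"
proof -
  have "(\<Sum>i<N. \<Sum>j<N. X i j * (f i)\<^sup>2) = (\<Sum>i<N. (f i)\<^sup>2)"
    by (simp add: row_sum flip: sum_distrib_right)
  moreover have "(\<Sum>i<N. \<Sum>j<N. X i j * (f j)\<^sup>2) = (\<Sum>i<N. (f i)\<^sup>2)"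
    by (subst sum.swap) (simp add: col_sum flip: sum_distrib_right)
  moreover have "(\<Sum>i<N. \<Sum>j<N. X i j * ((f i - f j) * (f i - f j))) =
      (\<Sum>i<N. \<Sum>j<N. X i j * (f i)\<^sup>2) + (\<Sum>i<N. \<Sum>j<N. X i j * (f j)\<^sup>2)
        - 2 * (\<Sum>i<N. \<Sum>j<N. X i j * (f i * f j))"
    unfolding sum_distrib_left sum.distrib[symmetric] sum_subtractf[symmetric]
    by (intro sum.cong refl) (simp add: power2_eq_square algebra_simps)
  ultimately show ?thesis
    by (simp add: dirichlet_def)
qed

lemma dirichlet_le: "dirichlet N X f f \<le> (\<Sum>i<N. (f i)\<^sup>2)"
  using psd[of f] by (simp add: dirichlet_self ac_simps)

text \<open>AM-GM for each pair, weighted by \<open>X i j\<close>. The unequal weights leave only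
  half of the first form, so that the center energy can be absorbed on the left later.\<close>

lemma dirichlet_cross: "- 2 * dirichlet N X f g \<le> dirichlet N X f f / 2 + 2 * dirichlet N X g g"
proof -
  have "- 2 * dirichlet N X f g = (\<Sum>i<N. \<Sum>j<N. - (X i j * ((f i - f j) * (g i - g j))))"
    by (simp add: dirichlet_def sum_negf)
  also have "\<dots> \<le> (\<Sum>i<N. \<Sum>j<N. X i j * ((f i - f j) * (f i - f j)) / 4 + X i j * ((g i - g j) * (g i - g j)))"
  proof (intro sum_mono)
    fix i j assume ij: "i \<in> {..<N}" "j \<in> {..<N}"
    have "0 \<le> X i j * ((f i - f j) / 2 + (g i - g j))\<^sup>2"
      using ij nonneg by simp
    then show "- (X i j * ((f i - f j) * (g i - g j))) \<le>
        X i j * ((f i - f j) * (f i - f j)) / 4 + X i j * ((g i - g j) * (g i - g j))"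
      by (simp add: power2_eq_square algebra_simps)
  qed
  also have "\<dots> = dirichlet N X f f / 2 + 2 * dirichlet N X g g"
    by (simp add: dirichlet_def sum.distrib flip: sum_divide_distrib)
  finally show ?thesis .
qed

text \<open>Positive semidefiniteness tested on the difference of two unit vectors.\<close>

lemma entry_le_diag:
  assumes "i < N" "j < N"
  shows "X i j \<le> (X i i + X j j) / 2"
proof (cases "i = j")
  case False
  define v :: "nat \<Rightarrow> real" where "v = (\<lambda>a. (if a = i then 1 else 0) - (if a = j then 1 else 0))"
  have "(\<Sum>a<N. \<Sum>b<N. v a * X a b * v b) = X i i - X i j - (X j i - X j j)"
    using assms by (simp add: v_def mult_delta_left mult_delta_right left_diff_distrib right_diff_distrib
        sum_subtractf)
  then show ?thesis
    using psd[of v] sym[OF assms] by simp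
qed simp

text \<open>One factor of each square is replaced by the mean of two diagonal entries; row and
  column sums 1 then remove the other factor.\<close>

lemma sum_squares_le_trace: "(\<Sum>i<N. \<Sum>j<N. (X i j)\<^sup>2) \<le> (\<Sum>i<N. X i i)"
proof -
  have "(\<Sum>i<N. \<Sum>j<N. (X i j)\<^sup>2) \<le> (\<Sum>i<N. \<Sum>j<N. X i j * (X i i + X j j) / 2)"
  proof (intro sum_mono)
    fix i j assume "i \<in> {..<N}" "j \<in> {..<N}"
    then show "(X i j)\<^sup>2 \<le> X i j * (X i i + X j j) / 2"
      using mult_left_mono[OF entry_le_diag nonneg, of i j i j] by (simp add: power2_eq_square)
  qed
  also have "\<dots> = ((\<Sum>i<N. \<Sum>j<N. X i j * X i i) + (\<Sum>i<N. \<Sum>j<N. X i j * X j j)) / 2"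
    by (simp add: sum_divide_distrib distrib_left sum.distrib add_divide_distrib)
  also have "(\<Sum>i<N. \<Sum>j<N. X i j * X i i) = (\<Sum>i<N. X i i)"
    by (simp add: row_sum flip: sum_distrib_right)
  also have "(\<Sum>i<N. \<Sum>j<N. X i j * X j j) = (\<Sum>i<N. X i i)"
    by (subst sum.swap) (simp add: col_sum flip: sum_distrib_right)
  finally show ?thesis by simp
qed

text \<open>With X = sum_s y_s y_s^T the left side is sum_s |z^T y_s|^2, and the squared lengths of
  the y_s add up to the trace.\<close>

lemma gram_le_trace:
  assumes opnorm: "\<And>v. (\<Sum>l<m. (\<Sum>i<N. z i l * v i)\<^sup>2) \<le> L * (\<Sum>i<N. (v i)\<^sup>2)"
  shows "(\<Sum>l<m. \<Sum>i<N. \<Sum>j<N. X i j * (z i l * z j l)) \<le> L * (\<Sum>i<N. X i i)"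
proof -
  obtain y where y: "\<And>i j. i < N \<Longrightarrow> j < N \<Longrightarrow> X i j = (\<Sum>s<N. y s i * y s j)"
    using psd_factorization[of N X] sym psd by blast
  have "(\<Sum>i<N. \<Sum>j<N. X i j * (z i l * z j l)) = (\<Sum>s<N. (\<Sum>i<N. z i l * y s i)\<^sup>2)" for l
  proof -
    have "X i j * (z i l * z j l) = (\<Sum>s<N. (z i l * y s i) * (z j l * y s j))"
      if "i < N" "j < N" for i j
      unfolding y[OF that] sum_distrib_right by (intro sum.cong refl) (simp add: ac_simps)
    then have "(\<Sum>i<N. \<Sum>j<N. X i j * (z i l * z j l)) =
        (\<Sum>i<N. \<Sum>j<N. \<Sum>s<N. (z i l * y s i) * (z j l * y s j))"
      by simp
    also have "\<dots> = (\<Sum>s<N. \<Sum>i<N. \<Sum>j<N. (z i l * y s i) * (z j l * y s j))"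
      by (subst sum.swap, subst (2) sum.swap, rule refl)
    finally show ?thesis
      by (simp add: power2_eq_square sum_product)
  qed
  then have "(\<Sum>l<m. \<Sum>i<N. \<Sum>j<N. X i j * (z i l * z j l)) = (\<Sum>s<N. \<Sum>l<m. (\<Sum>i<N. z i l * y s i)\<^sup>2)"
    by (simp only:) (rule sum.swap)
  also have "\<dots> \<le> (\<Sum>s<N. L * (\<Sum>i<N. (y s i)\<^sup>2))"
    by (intro sum_mono opnorm)
  also have "\<dots> = L * (\<Sum>i<N. X i i)"
    unfolding sum_distrib_left[symmetric] by (subst sum.swap) (simp add: y power2_eq_square)
  finally show ?thesis .
qed

end

text \<open>The net argument bounds z on R^m, while \<open>gram_le_trace\<close> needs its transpose
  on R^N. For w = z^T v, Cauchy-Schwarz applied to |w|^2 = <v, z w> gives |w|^4 <= |v|^2 L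
  |w|^2.\<close>

lemma opnorm_adjoint:
  fixes z :: "nat \<Rightarrow> nat \<Rightarrow> real"
  assumes "L \<ge> 0" and opnorm: "\<And>v. (\<Sum>i<N. (\<Sum>l<m. z i l * v l)\<^sup>2) \<le> L * (\<Sum>l<m. (v l)\<^sup>2)"
  shows "(\<Sum>l<m. (\<Sum>i<N. z i l * v i)\<^sup>2) \<le> L * (\<Sum>i<N. (v i)\<^sup>2)"
proof -
  define w where "w = (\<lambda>l. \<Sum>i<N. z i l * v i)"
  define S where "S = (\<Sum>l<m. (w l)\<^sup>2)"
  have S0: "S \<ge> 0"
    by (simp add: S_def sum_nonneg)
  have "S = (\<Sum>l<m. \<Sum>i<N. v i * (z i l * w l))"
    by (simp add: S_def power2_eq_square) (simp add: w_def sum_distrib_right ac_simps)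
  also have "\<dots> = (\<Sum>i<N. v i * (\<Sum>l<m. z i l * w l))"
    by (subst sum.swap) (simp add: sum_distrib_left)
  finally have "S\<^sup>2 \<le> (\<Sum>i<N. (v i)\<^sup>2) * (\<Sum>i<N. (\<Sum>l<m. z i l * w l)\<^sup>2)"
    using Cauchy_Schwarz_ineq_sum[of v "\<lambda>i. \<Sum>l<m. z i l * w l" "{..<N}"] by simp
  also have "\<dots> \<le> (\<Sum>i<N. (v i)\<^sup>2) * (L * S)"
    unfolding S_def by (intro mult_left_mono opnorm sum_nonneg) simp
  finally have *: "S * S \<le> (L * (\<Sum>i<N. (v i)\<^sup>2)) * S"
    by (simp add: power2_eq_square ac_simps)
  show ?thesis
  proof (cases "S = 0")
    case False
    then show ?thesis
      using * S0 by (simp add: S_def w_def)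
  next
    case True
    have "0 \<le> L * (\<Sum>i<N. (v i)\<^sup>2)"
      using \<open>L \<ge> 0\<close> by (simp add: sum_nonneg)
    then show ?thesis
      using True by (simp add: S_def w_def)
  qed
qed

section \<open>Center, cross and noise terms of the objective\<close>

lemma dirichlet_add:
  "dirichlet N X (\<lambda>i. f i + g i) (\<lambda>i. f i + g i) =
     dirichlet N X f f + 2 * dirichlet N X f g + dirichlet N X g g"
proof -
  have "(\<Sum>i<N. \<Sum>j<N. X i j * ((f i + g i - (f j + g j)) * (f i + g i - (f j + g j)))) =
      (\<Sum>i<N. \<Sum>j<N. X i j * ((f i - f j) * (f i - f j))) +
      2 * (\<Sum>i<N. \<Sum>j<N. X i j * ((f i - f j) * (g i - g j))) +
      (\<Sum>i<N. \<Sum>j<N. X i j * ((g i - g j) * (g i - g j)))"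
    unfolding sum_distrib_left sum.distrib[symmetric]
    by (intro sum.cong refl) (simp add: algebra_simps)
  then show ?thesis
    by (simp add: dirichlet_def add_divide_distrib)
qed

lemma sum_dirichlet:
  "(\<Sum>l<m. dirichlet N X (f l) (g l)) =
     (\<Sum>i<N. \<Sum>j<N. X i j * (\<Sum>l<m. (f l i - f l j) * (g l i - g l j))) / 2"
proof -
  have "(\<Sum>l<m. \<Sum>i<N. \<Sum>j<N. X i j * ((f l i - f l j) * (g l i - g l j))) =
      (\<Sum>i<N. \<Sum>j<N. \<Sum>l<m. X i j * ((f l i - f l j) * (g l i - g l j)))"
    by (subst sum.swap, subst (2) sum.swap, rule refl)
  then show ?thesis
    by (simp add: dirichlet_def sum_distrib_left flip: sum_divide_distrib)
qed

text \<open>Serves for the reference matrix and a coordinate of the centers, which is constant on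
  each block.\<close>

lemma dirichlet_eq_0:
  assumes "\<And>i j. i < N \<Longrightarrow> j < N \<Longrightarrow> X i j \<noteq> 0 \<Longrightarrow> f i = f j"
  shows "dirichlet N X f g = 0"
proof -
  have "X i j * ((f i - f j) * (g i - g j)) = 0" if "i < N" "j < N" for i j
    using assms[OF that] by (cases "X i j = 0") auto
  then have "(\<Sum>i<N. \<Sum>j<N. X i j * ((f i - f j) * (g i - g j))) = 0"
    by (intro sum.neutral ballI) simp
  then show ?thesis
    by (simp add: dirichlet_def)
qed

lemma kmeans_sdp_separation:
  fixes x \<gamma> X R :: "nat \<Rightarrow> nat \<Rightarrow> real"
  assumes X: "stochastic_psd N X" and R: "stochastic_psd N R"
    and lab: "\<And>i. i < N \<Longrightarrow> lab i < k"
    and block: "\<And>i j. i < N \<Longrightarrow> j < N \<Longrightarrow> lab i \<noteq> lab j \<Longrightarrow> R i j = 0"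
    and trace: "(\<Sum>i<N. X i i) = real k"
    and opt: "(\<Sum>i<N. \<Sum>j<N. X i j * (\<Sum>l<m. (x i l - x j l)\<^sup>2)) \<le>
              (\<Sum>i<N. \<Sum>j<N. R i j * (\<Sum>l<m. (x i l - x j l)\<^sup>2))"
    and "L \<ge> 0"
    and opnorm: "\<And>v. (\<Sum>i<N. (\<Sum>l<m. (x i l - \<gamma> (lab i) l) * v l)\<^sup>2) \<le> L * (\<Sum>l<m. (v l)\<^sup>2)"
  shows "(\<Sum>i<N. \<Sum>j<N. X i j * (\<Sum>l<m. (\<gamma> (lab i) l - \<gamma> (lab j) l)\<^sup>2)) \<le> 12 * real k * L"
proof -
  interpret X: stochastic_psd N X by fact
  interpret R: stochastic_psd N R by fact
  define M where "M = (\<lambda>l i. \<gamma> (lab i) l)"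
  define Z where "Z = (\<lambda>l i. x i l - \<gamma> (lab i) l)"
  define A where "A = (\<Sum>l<m. dirichlet N X (M l) (M l))"
  have A_eq: "(\<Sum>i<N. \<Sum>j<N. X i j * (\<Sum>l<m. (\<gamma> (lab i) l - \<gamma> (lab j) l)\<^sup>2)) = 2 * A"
    by (simp add: A_def sum_dirichlet M_def power2_eq_square)
  have objective: "(\<Sum>i<N. \<Sum>j<N. Y i j * (\<Sum>l<m. (x i l - x j l)\<^sup>2)) =
      2 * (\<Sum>l<m. dirichlet N Y (M l) (M l) + 2 * dirichlet N Y (M l) (Z l) + dirichlet N Y (Z l) (Z l))" for Y
    unfolding dirichlet_add[symmetric] sum_dirichlet by (simp add: M_def Z_def power2_eq_square)
  have "dirichlet N R (M l) g = 0" for l g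
    using block unfolding M_def by (intro dirichlet_eq_0) metis
  then have "A + 2 * (\<Sum>l<m. dirichlet N X (M l) (Z l)) + (\<Sum>l<m. dirichlet N X (Z l) (Z l)) \<le>
      (\<Sum>l<m. dirichlet N R (Z l) (Z l))"
    using opt unfolding objective by (simp add: A_def sum.distrib flip: sum_distrib_left)
  \<comment> \<open>Only the nonnegative quadratic form of \<open>R\<close> is discarded. The
    remaining noise energy cancels against the one that \<open>dirichlet_self\<close> produces for
    \<open>X\<close>.\<close>
  also have "\<dots> \<le> (\<Sum>l<m. \<Sum>i<N. (Z l i)\<^sup>2)"
    by (intro sum_mono R.dirichlet_le)
  finally have "A \<le> (\<Sum>l<m. \<Sum>i<N. \<Sum>j<N. X i j * (Z l i * Z l j)) - 2 * (\<Sum>l<m. dirichlet N X (M l) (Z l))"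
    by (simp add: X.dirichlet_self sum_subtractf)
  moreover have "(\<Sum>l<m. \<Sum>i<N. \<Sum>j<N. X i j * (Z l i * Z l j)) \<le> L * real k"
    using X.gram_le_trace[where m = m and L = L and z = "\<lambda>i l. Z l i"] opnorm_adjoint[OF \<open>L \<ge> 0\<close> opnorm] trace
    by (simp add: Z_def)
  moreover have "- 2 * (\<Sum>l<m. dirichlet N X (M l) (Z l)) \<le> A / 2 + 2 * (real k * L)"
  proof -
    obtain u r where r: "r \<le> k"
      and on: "\<And>s s'. s < r \<Longrightarrow> s' < r \<Longrightarrow> dot m (u s) (u s') = of_bool (s = s')"
      and rep: "\<And>t l. t < k \<Longrightarrow> l < m \<Longrightarrow> \<gamma> t l = (\<Sum>s<r. dot m (\<gamma> t) (u s) * u s l)"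
      using span_orthonormal_basis[of k m \<gamma>] by blast
    \<comment> \<open>Since the centers lie in the span of the \<open>u s\<close>, pairing them with
      any \<open>y\<close> sees only the projection of \<open>y\<close> to that span.\<close>
    have parseval: "dot m (\<gamma> t) y = (\<Sum>s<r. dot m (\<gamma> t) (u s) * dot m y (u s))" if "t < k" for t y
    proof -
      have "dot m (\<gamma> t) y = (\<Sum>l<m. \<Sum>s<r. dot m (\<gamma> t) (u s) * (y l * u s l))"
        unfolding dot_def[of m _ y]
        by (intro sum.cong refl, subst rep[OF that]) (simp_all add: sum_distrib_left ac_simps)
      also have "\<dots> = (\<Sum>s<r. dot m (\<gamma> t) (u s) * dot m y (u s))"
        by (subst sum.swap) (simp add: dot_def sum_distrib_left)
      finally show ?thesis .
    qed
    have dot_diff: "dot m (\<lambda>l. f l - g l) h = dot m f h - dot m g h" for f g h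
      by (simp add: dot_def left_diff_distrib sum_subtractf)
    define MU where "MU = (\<lambda>s i. dot m (\<gamma> (lab i)) (u s))"
    define pr where "pr = (\<lambda>Y :: nat \<Rightarrow> nat \<Rightarrow> real. \<lambda>s i. dot m (\<lambda>l. Y l i) (u s))"
    \<comment> \<open>This trades the sum over m coordinates for one over r directions. It is used
      for \<open>Z\<close> in the cross term and for \<open>M\<close> to recover
      \<open>A\<close>.\<close>
    have proj: "(\<Sum>l<m. dirichlet N X (M l) (Y l)) = (\<Sum>s<r. dirichlet N X (MU s) (pr Y s))" for Y
    proof -
      have "(\<Sum>l<m. (M l i - M l j) * (Y l i - Y l j)) = (\<Sum>s<r. (MU s i - MU s j) * (pr Y s i - pr Y s j))"
        if "i < N" "j < N" for i j
      proof -
        let ?y = "\<lambda>l. Y l i - Y l j"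
        have "(\<Sum>l<m. (M l i - M l j) * ?y l) = dot m (\<gamma> (lab i)) ?y - dot m (\<gamma> (lab j)) ?y"
          by (simp add: M_def dot_def left_diff_distrib sum_subtractf)
        also have "\<dots> = (\<Sum>s<r. (MU s i - MU s j) * dot m ?y (u s))"
          by (simp add: parseval[OF lab, of _ ?y] that MU_def left_diff_distrib sum_subtractf)
        also have "\<dots> = (\<Sum>s<r. (MU s i - MU s j) * (pr Y s i - pr Y s j))"
          by (simp add: dot_diff pr_def)
        finally show ?thesis .
      qed
      then show ?thesis
        by (simp add: sum_dirichlet)
    qed
    have pr_M: "pr M = MU"
      by (simp add: pr_def M_def MU_def fun_eq_iff)
    have noise: "dirichlet N X (pr Z s) (pr Z s) \<le> L" if "s < r" for s
    proof -
      have "dirichlet N X (pr Z s) (pr Z s) \<le> (\<Sum>i<N. (pr Z s i)\<^sup>2)"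
        by (rule X.dirichlet_le)
      also have "\<dots> \<le> L * dot m (u s) (u s)"
        using opnorm[of "u s"] by (simp add: pr_def Z_def dot_def power2_eq_square)
      finally show ?thesis
        using that by (simp add: on)
    qed
    have "- 2 * (\<Sum>l<m. dirichlet N X (M l) (Z l)) = (\<Sum>s<r. - 2 * dirichlet N X (MU s) (pr Z s))"
      unfolding proj by (simp add: sum_distrib_left)
    also have "\<dots> \<le> (\<Sum>s<r. dirichlet N X (MU s) (MU s) / 2 + 2 * L)"
    proof (rule sum_mono)
      fix s assume "s \<in> {..<r}"
      then show "- 2 * dirichlet N X (MU s) (pr Z s) \<le> dirichlet N X (MU s) (MU s) / 2 + 2 * L"
        using X.dirichlet_cross[of "MU s" "pr Z s"] noise[of s] by simp
    qed
    also have "\<dots> = A / 2 + 2 * (real r * L)"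
      using proj[of M] by (simp add: A_def pr_M sum.distrib flip: sum_divide_distrib)
    also have "\<dots> \<le> A / 2 + 2 * (real k * L)"
      using r \<open>L \<ge> 0\<close> by (simp add: mult_right_mono)
    finally show ?thesis .
  qed
  \<comment> \<open>From A <= kL + A/2 + 2kL.\<close>
  ultimately have "A \<le> 6 * (real k * L)"
    by (simp add: mult.commute)
  then show ?thesis
    unfolding A_eq by (simp add: algebra_simps)
qed

section \<open>Cluster counting and the distance to the reference matrix\<close>

lemma sum_of_bool_lab: "(\<Sum>j<N. of_bool (lab i = lab j)) = real (cluster_size N lab (lab i))"
proof -
  have "{..<N} \<inter> {j. lab i = lab j} = {j. j < N \<and> lab j = lab i}"
    by auto
  then show ?thesis
    by (simp add: cluster_size_def)
qed

text \<open>Each cluster contributes its size times the reciprocal. The sum is both the trace and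
  the squared Frobenius norm of the reference matrix.\<close>

lemma sum_inverse_cluster_size:
  assumes "\<And>i. i < N \<Longrightarrow> lab i < k" and "\<And>t. t < k \<Longrightarrow> cluster_size N lab t \<ge> 1"
  shows "(\<Sum>i<N. 1 / real (cluster_size N lab (lab i))) = real k"
proof -
  have "(\<Sum>i<N. 1 / real (cluster_size N lab (lab i))) =
      (\<Sum>t<k. \<Sum>i | i \<in> {..<N} \<and> lab i = t. 1 / real (cluster_size N lab (lab i)))"
    using assms(1) by (intro sum.group[symmetric]) auto
  also have "\<dots> = (\<Sum>t<k. 1)"
  proof (intro sum.cong refl)
    fix t assume "t \<in> {..<k}"
    have "(\<Sum>i | i \<in> {..<N} \<and> lab i = t. 1 / real (cluster_size N lab (lab i))) =
        (\<Sum>i | i < N \<and> lab i = t. 1 / real (cluster_size N lab t))"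
      by (intro sum.cong) auto
    also have "\<dots> = 1"
      using assms(2)[of t] \<open>t \<in> {..<k}\<close> by (simp flip: cluster_size_def)
    finally show "(\<Sum>i | i \<in> {..<N} \<and> lab i = t. 1 / real (cluster_size N lab (lab i))) = 1" .
  qed
  finally show ?thesis
    by simp
qed

text \<open>In |X|^2 - 2<X,R> + |R|^2 the outer terms are at most k and equal to k, so the deviation
  is governed by how far <X,R> falls below k.\<close>

lemma frobenius_block_deviation:
  fixes X :: "nat \<Rightarrow> nat \<Rightarrow> real"
  assumes X: "stochastic_psd N X"
    and lab: "\<And>i. i < N \<Longrightarrow> lab i < k"
    and b: "b > 0" "\<And>t. t < k \<Longrightarrow> b \<le> cluster_size N lab t"
    and trace: "(\<Sum>i<N. X i i) = real k"
  defines "R \<equiv> \<lambda>i j. of_bool (lab i = lab j) / real (cluster_size N lab (lab i))"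
  shows "(\<Sum>i<N. \<Sum>j<N. (X i j - R i j)\<^sup>2) \<le> 2 * (\<Sum>i<N. \<Sum>j<N. X i j * of_bool (lab i \<noteq> lab j)) / real b"
proof -
  interpret X: stochastic_psd N X by fact
  define n where "n = cluster_size N lab"
  define w where "w = (\<lambda>i. \<Sum>j<N. X i j * of_bool (lab i \<noteq> lab j))"
  have R: "R = (\<lambda>i j. of_bool (lab i = lab j) / real (n (lab i)))"
    by (simp add: R_def n_def)
  have n_pos: "0 < n (lab i)" if "i < N" for i
    using b lab[OF that] unfolding n_def by fastforce
  have clusters: "(\<Sum>i<N. 1 / real (n (lab i))) = real k"
    unfolding n_def using lab by (rule sum_inverse_cluster_size) (use b in fastforce)+
  have RR: "(\<Sum>i<N. \<Sum>j<N. (R i j)\<^sup>2) = real k"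
  proof -
    have "(\<Sum>j<N. (R i j)\<^sup>2) = 1 / real (n (lab i))" if "i < N" for i
    proof -
      have "(\<Sum>j<N. (R i j)\<^sup>2) = (\<Sum>j<N. of_bool (lab i = lab j)) / (real (n (lab i)))\<^sup>2"
        unfolding sum_divide_distrib by (intro sum.cong refl) (simp add: R power_divide)
      then show ?thesis
        using sum_of_bool_lab[where N = N and lab = lab and i = i] by (simp add: power2_eq_square n_def)
    qed
    then show ?thesis
      using clusters by simp
  qed
  \<comment> \<open>Row i keeps mass 1 - \<open>w i\<close> inside its block, where R has the
    constant value 1 / \<open>n (lab i)\<close>; the loss is at most \<open>w i\<close> / b because
    clusters have at least b points.\<close>
  have "real k - (\<Sum>i<N. w i) / real b = (\<Sum>i<N. 1 / real (n (lab i)) - w i / real b)"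
    by (simp add: clusters sum_subtractf sum_divide_distrib)
  also have "\<dots> \<le> (\<Sum>i<N. \<Sum>j<N. X i j * R i j)"
  proof (rule sum_mono)
    fix i assume "i \<in> {..<N}"
    then have i: "i < N" by simp
    have "1 - w i = (\<Sum>j<N. X i j * of_bool (lab i = lab j))"
      unfolding w_def X.row_sum[OF i, symmetric] sum_subtractf[symmetric] by (intro sum.cong) auto
    then have "(\<Sum>j<N. X i j * R i j) = (1 - w i) / real (n (lab i))"
      unfolding R sum_divide_distrib by (simp only: sum_divide_distrib times_divide_eq_right)
    moreover have "w i / real (n (lab i)) \<le> w i / real b"
      using b lab[OF i] X.nonneg[OF i] by (intro divide_left_mono) (auto simp: w_def n_def intro!: sum_nonneg mult_pos_pos n_pos[OF i, unfolded n_def])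
    ultimately show "1 / real (n (lab i)) - w i / real b \<le> (\<Sum>j<N. X i j * R i j)"
      by (simp add: diff_divide_distrib)
  qed
  finally have XR: "real k - (\<Sum>i<N. w i) / real b \<le> (\<Sum>i<N. \<Sum>j<N. X i j * R i j)" .
  have "(\<Sum>i<N. \<Sum>j<N. (X i j - R i j)\<^sup>2) =
      (\<Sum>i<N. \<Sum>j<N. (X i j)\<^sup>2) - 2 * (\<Sum>i<N. \<Sum>j<N. X i j * R i j) + (\<Sum>i<N. \<Sum>j<N. (R i j)\<^sup>2)"
    unfolding sum_distrib_left sum.distrib[symmetric] sum_subtractf[symmetric]
    by (intro sum.cong refl) (simp add: power2_diff)
  also have "\<dots> \<le> 2 * ((\<Sum>i<N. w i) / real b)"
    using X.sum_squares_le_trace trace XR RR by simp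
  finally show ?thesis
    by (simp add: w_def)
qed

subsection \<open>The operator norm of a subgaussian sample\<close>

text \<open>Integer points of the ball of radius 2 sqrt m. The box makes finiteness immediate and
  cuts off nothing, since 4m <= (2m)^2 for m >= 1.\<close>

definition grid :: "nat \<Rightarrow> (nat \<Rightarrow> int) set" where
  "grid m = {z \<in> {..<m} \<rightarrow>\<^sub>E {- (2 * int m)..2 * int m}. (\<Sum>j<m. (z j)\<^sup>2) \<le> 4 * int m}"

text \<open>After scaling, cells have side 1 / (2 sqrt m) and hence diameter 1/2. Values at indices
  from \<open>m\<close> on are irrelevant, as all sums stop below \<open>m\<close>.\<close>

definition net :: "nat \<Rightarrow> (nat \<Rightarrow> real) set" where
  "net m = (\<lambda>z j. real_of_int (z j) / (2 * sqrt (real m))) ` grid m"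

lemma finite_grid: "finite (grid m)"
  unfolding grid_def by (rule finite_subset[OF _ finite_PiE[of "{..<m}" "\<lambda>_. {- (2 * int m)..2 * int m}"]]) auto

lemma finite_net: "finite (net m)"
  by (simp add: net_def finite_grid)

lemma sum_exp_neg_square_le: "(\<Sum>a\<in>{- int b..int b}. exp (- (real_of_int a)\<^sup>2)) \<le> 3"
proof -
  \<comment> \<open>The bound is strengthened for the induction: the two new terms are at most 2
    (1/2)^(b+1), which is exactly what the correction releases.\<close>
  have "(\<Sum>a\<in>{- int b..int b}. exp (- (real_of_int a)\<^sup>2)) \<le> 3 - 2 * (1 / 2) ^ b"
  proof (induction b)
    case 0
    show ?case by simp
  next
    case (Suc b)
    have "{- int (Suc b)..int (Suc b)} = insert (int (Suc b)) (insert (- int (Suc b)) {- int b..int b})"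
      by auto
    then have "(\<Sum>a\<in>{- int (Suc b)..int (Suc b)}. exp (- (real_of_int a)\<^sup>2)) =
        (\<Sum>a\<in>{- int b..int b}. exp (- (real_of_int a)\<^sup>2)) + 2 * exp (- (real (Suc b))\<^sup>2)"
      by (simp add: power2_eq_square algebra_simps)
    also have "exp (- (real (Suc b))\<^sup>2) \<le> (1 / 2) ^ Suc b"
    proof -
      have "exp (- (real (Suc b))\<^sup>2) \<le> exp (real (Suc b) * (- 1))"
        by (simp add: power2_eq_square algebra_simps)
      also have "\<dots> = exp (- 1) ^ Suc b"
        by (rule exp_of_nat_mult)
      also have "\<dots> \<le> (1 / 2) ^ Suc b"
        using exp_ge_add_one_self[of 1] by (intro power_mono) (auto simp: exp_minus field_simps)
      finally show ?thesis .
    qed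
    finally show ?case
      using Suc by simp
  qed
  then show ?thesis
    by (smt (verit) zero_le_power divide_nonneg_nonneg)
qed

text \<open>Exponential weights replace a volume argument: every grid point has exp(4m - |z|^2) >=
  1, and over the full box these weights factor into m one-dimensional sums, each at most 3 <= exp
  2.\<close>

lemma card_grid_le: "real (card (grid m)) \<le> exp (6 * real m)"
proof -
  let ?B = "{..<m} \<rightarrow>\<^sub>E {- (2 * int m)..2 * int m}"
  have fin: "finite ?B"
    by (intro finite_PiE) auto
  have "real (card (grid m)) = (\<Sum>z\<in>grid m. 1)"
    by simp
  also have "\<dots> \<le> (\<Sum>z\<in>grid m. exp (4 * real m) * exp (- (\<Sum>j<m. (real_of_int (z j))\<^sup>2)))"
  proof (rule sum_mono)
    fix z assume "z \<in> grid m"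
    then have "real_of_int (\<Sum>j<m. (z j)\<^sup>2) \<le> real_of_int (4 * int m)"
      unfolding grid_def of_int_le_iff by simp
    then show "1 \<le> exp (4 * real m) * exp (- (\<Sum>j<m. (real_of_int (z j))\<^sup>2))"
      by (simp flip: exp_add)
  qed
  also have "\<dots> \<le> (\<Sum>z\<in>?B. exp (4 * real m) * exp (- (\<Sum>j<m. (real_of_int (z j))\<^sup>2)))"
    using fin by (intro sum_mono2) (auto simp: grid_def)
  also have "\<dots> = exp (4 * real m) * (\<Sum>z\<in>?B. \<Prod>j<m. exp (- (real_of_int (z j))\<^sup>2))"
    by (simp add: exp_sum sum_distrib_left flip: sum_negf)
  also have "(\<Sum>z\<in>?B. \<Prod>j<m. exp (- (real_of_int (z j))\<^sup>2)) =
      (\<Prod>j<m. \<Sum>a\<in>{- (2 * int m)..2 * int m}. exp (- (real_of_int a)\<^sup>2))"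
    by (rule prod_sum_PiE[symmetric]) auto
  also have "\<dots> \<le> (\<Prod>j<m. 3)"
    using sum_exp_neg_square_le[of "2 * m"] by (intro prod_mono) (auto intro!: sum_nonneg)
  also have "\<dots> = 3 ^ m"
    by simp
  also have "(3::real) ^ m \<le> exp 2 ^ m"
    using exp_ge_add_one_self[of 2] by (intro power_mono) auto
  also have "exp (2 :: real) ^ m = exp (2 * real m)"
    by (simp add: exp_of_nat_mult[symmetric] mult.commute)
  finally show ?thesis
    by (simp flip: exp_add)
qed

lemma card_net_le: "real (card (net m)) \<le> exp (6 * real m)"
proof -
  have "card (net m) \<le> card (grid m)"
    unfolding net_def by (rule card_image_le[OF finite_grid])
  then show ?thesis
    using card_grid_le[of m] by linarith
qed

lemma net_sum_squares_le_1:
  assumes "w \<in> net m"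
  shows "(\<Sum>j<m. (w j)\<^sup>2) \<le> 1"
proof -
  obtain z where z: "z \<in> grid m" and w: "w = (\<lambda>j. real_of_int (z j) / (2 * sqrt (real m)))"
    using assms by (auto simp: net_def)
  have "real_of_int (\<Sum>j<m. (z j)\<^sup>2) \<le> real_of_int (4 * int m)"
    using z unfolding grid_def of_int_le_iff by simp
  then have "(\<Sum>j<m. (real_of_int (z j))\<^sup>2) / (4 * real m) \<le> 1"
    by (cases "m = 0") auto
  then show ?thesis
    by (simp add: w power_divide power_mult_distrib sum_divide_distrib)
qed

(* Rounding towards zero keeps the rounded vector inside the ball. *)
lemma net_approx:
  assumes v: "(\<Sum>j<m. (v j)\<^sup>2) \<le> 1"
  shows "\<exists>w\<in>net m. (\<Sum>j<m. (v j - w j)\<^sup>2) \<le> 1 / 4"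
proof (cases "m = 0")
  case True
  then show ?thesis
    by (auto simp: net_def grid_def)
next
  case False
  define c where "c = 2 * sqrt (real m)"
  have c: "c > 0" "c\<^sup>2 = 4 * real m"
    using False by (auto simp: c_def power_mult_distrib)
  define z where "z = (\<lambda>j\<in>{..<m}. if v j \<ge> 0 then \<lfloor>c * v j\<rfloor> else \<lceil>c * v j\<rceil>)"
  have z: "\<bar>real_of_int (z j)\<bar> \<le> \<bar>c * v j\<bar>" "\<bar>c * v j - real_of_int (z j)\<bar> \<le> 1" if "j < m" for j
  proof -
    have "\<bar>real_of_int (z j)\<bar> \<le> \<bar>c * v j\<bar> \<and> \<bar>c * v j - real_of_int (z j)\<bar> \<le> 1"
    proof (cases "v j \<ge> 0")
      case True
      then have "z j = \<lfloor>c * v j\<rfloor>" "0 \<le> c * v j"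
        using that c by (simp_all add: z_def)
      moreover then have "0 \<le> real_of_int (z j)"
        by simp
      ultimately show ?thesis
        by linarith
    next
      case False
      then have "z j = \<lceil>c * v j\<rceil>" "c * v j \<le> 0"
        using that c by (simp_all add: z_def mult_le_0_iff)
      moreover then have "real_of_int (z j) \<le> 0"
        by simp
      ultimately show ?thesis
        by linarith
    qed
    then show "\<bar>real_of_int (z j)\<bar> \<le> \<bar>c * v j\<bar>" "\<bar>c * v j - real_of_int (z j)\<bar> \<le> 1"
      by auto
  qed
  have "(\<Sum>j<m. (real_of_int (z j))\<^sup>2) \<le> (\<Sum>j<m. (c * v j)\<^sup>2)"
    using z(1) by (intro sum_mono) (simp add: abs_le_square_iff)
  also have "\<dots> = c\<^sup>2 * (\<Sum>j<m. (v j)\<^sup>2)"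
    by (simp add: power_mult_distrib sum_distrib_left)
  also have "\<dots> \<le> 4 * real m"
    using v c by (simp add: mult_left_le)
  finally have "real_of_int (\<Sum>j<m. (z j)\<^sup>2) \<le> real_of_int (4 * int m)"
    by simp
  then have sq: "(\<Sum>j<m. (z j)\<^sup>2) \<le> 4 * int m"
    by (simp only: of_int_le_iff)
  have "\<bar>z j\<bar> \<le> 2 * int m" if "j < m" for j
  proof -
    have "(z j)\<^sup>2 \<le> (\<Sum>j<m. (z j)\<^sup>2)"
      using that by (intro member_le_sum) auto
    also have "\<dots> \<le> (2 * int m)\<^sup>2"
    proof -
      have "m * 1 \<le> m * m"
        using False by (intro mult_left_mono) auto
      then have "int m \<le> int m * int m"
        by (simp flip: of_nat_mult)
      then show ?thesis
        using sq by (simp add: power_mult_distrib power2_eq_square)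
    qed
    finally have "\<bar>z j\<bar> \<le> \<bar>2 * int m\<bar>"
      by (simp only: abs_le_square_iff)
    then show ?thesis
      by simp
  qed
  then have "z \<in> grid m"
    using sq unfolding grid_def by (auto simp: z_def abs_le_iff) (force simp: z_def)+
  moreover have "(\<Sum>j<m. (v j - real_of_int (z j) / c)\<^sup>2) \<le> 1 / 4"
  proof -
    \<comment> \<open>Rounding moves \<open>c * v j\<close> by at most 1, and \<open>c\<close>^2 =
      4m.\<close>
    have "(\<Sum>j<m. (v j - real_of_int (z j) / c)\<^sup>2) \<le> (\<Sum>j<m. 1 / (4 * real m))"
    proof (rule sum_mono)
      fix j assume "j \<in> {..<m}"
      then have "(c * v j - real_of_int (z j))\<^sup>2 \<le> 1"
        using z(2)[of j] by (simp add: abs_square_le_1)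
      moreover have "v j - real_of_int (z j) / c = (c * v j - real_of_int (z j)) / c"
        using c by (simp add: field_simps)
      ultimately show "(v j - real_of_int (z j) / c)\<^sup>2 \<le> 1 / (4 * real m)"
        using c by (simp add: power_divide divide_right_mono)
    qed
    then show ?thesis
      using False by simp
  qed
  ultimately show ?thesis
    unfolding net_def c_def by auto
qed

text \<open>The supremum S over the ball satisfies S <= sqrt L + S/2, because a net point
  approximates up to distance 1/2. Hence S <= 2 sqrt L, which squares to the factor 4.\<close>

lemma opnorm_le_net:
  fixes a :: "nat \<Rightarrow> nat \<Rightarrow> real"
  assumes "\<And>w. w \<in> net m \<Longrightarrow> (\<Sum>i<N. (\<Sum>j<m. a i j * w j)\<^sup>2) \<le> L"
  shows "(\<Sum>i<N. (\<Sum>j<m. a i j * v j)\<^sup>2) \<le> 4 * L * (\<Sum>j<m. (v j)\<^sup>2)"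
proof -
  define q where "q = (\<lambda>v. L2_set (\<lambda>i. \<Sum>j<m. a i j * v j) {..<N})"
  define U where "U = {v :: nat \<Rightarrow> real. L2_set v {..<m} \<le> 1}"
  have U_iff: "v \<in> U \<longleftrightarrow> (\<Sum>j<m. (v j)\<^sup>2) \<le> 1" for v
    by (simp add: U_def L2_set_def)
  have q_scale: "q (\<lambda>j. c * v j) = \<bar>c\<bar> * q v" for c v
  proof -
    have "(\<Sum>j<m. a i j * (c * v j)) = c * (\<Sum>j<m. a i j * v j)" for i
      by (simp add: sum_distrib_left ac_simps)
    then show ?thesis
      by (simp add: q_def L2_set_def power_mult_distrib real_sqrt_mult flip: sum_distrib_left)
  qed
  have q_add: "q (\<lambda>j. v j + w j) \<le> q v + q w" for v w
    unfolding q_def distrib_left sum.distrib by (rule L2_set_triangle_ineq)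
  \<comment> \<open>A crude Frobenius bound ensures that the supremum is finite, so that S/2 may be
    subtracted.\<close>
  have "q v \<le> sqrt (\<Sum>i<N. \<Sum>j<m. (a i j)\<^sup>2)" if "v \<in> U" for v
  proof -
    have "(\<Sum>i<N. (\<Sum>j<m. a i j * v j)\<^sup>2) \<le> (\<Sum>i<N. \<Sum>j<m. (a i j)\<^sup>2)"
    proof (rule sum_mono)
      fix i
      have "(\<Sum>j<m. a i j * v j)\<^sup>2 \<le> (\<Sum>j<m. (a i j)\<^sup>2) * (\<Sum>j<m. (v j)\<^sup>2)"
        by (rule Cauchy_Schwarz_ineq_sum)
      also have "\<dots> \<le> (\<Sum>j<m. (a i j)\<^sup>2) * 1"
        using that by (intro mult_left_mono) (auto simp: U_iff sum_nonneg)
      finally show "(\<Sum>j<m. a i j * v j)\<^sup>2 \<le> (\<Sum>j<m. (a i j)\<^sup>2)"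
        by simp
    qed
    then show ?thesis
      by (simp add: q_def L2_set_def)
  qed
  then have bdd: "bdd_above (q ` U)"
    by (auto intro!: bdd_aboveI2)
  have U_0: "(\<lambda>_. 0) \<in> U"
    by (simp add: U_iff)
  define S where "S = (SUP v\<in>U. q v)"
  have S_upper: "q v \<le> S" if "v \<in> U" for v
    unfolding S_def using bdd that by (rule cSUP_upper2) simp
  have "(SUP v\<in>U. q v) \<le> sqrt L + (SUP v\<in>U. q v) / 2"
  proof (rule cSUP_least)
    show "U \<noteq> {}"
      using U_0 by auto
    fix v assume "v \<in> U"
    then obtain w where w: "w \<in> net m" "(\<Sum>j<m. (v j - w j)\<^sup>2) \<le> 1 / 4"
      using net_approx by (auto simp: U_iff)
    \<comment> \<open>Doubling the remainder brings it back into the unit ball, where S bounds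
      it.\<close>
    have "(\<Sum>j<m. (2 * (v j - w j))\<^sup>2) = 4 * (\<Sum>j<m. (v j - w j)\<^sup>2)"
      unfolding power_mult_distrib sum_distrib_left by simp
    then have "(\<lambda>j. 2 * (v j - w j)) \<in> U"
      using w by (simp add: U_iff)
    then have "q (\<lambda>j. 2 * (v j - w j)) \<le> S"
      by (rule S_upper)
    moreover have "q w \<le> sqrt L"
      using assms[OF w(1)] by (simp add: q_def L2_set_def)
    moreover have "q v \<le> q w + q (\<lambda>j. v j - w j)"
      using q_add[of w "\<lambda>j. v j - w j"] by simp
    ultimately show "q v \<le> sqrt L + (SUP v\<in>U. q v) / 2"
      using q_scale[where c = 2 and v = "\<lambda>j. v j - w j"] by (simp add: S_def)
  qed
  then have S: "S \<le> 2 * sqrt L"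
    by (simp add: S_def)
  obtain w where "w \<in> net m"
    using net_approx[where m = m and v = "\<lambda>_. 0"] by auto
  then have L0: "L \<ge> 0"
    by (intro order.trans[OF sum_nonneg assms]) simp_all
  have "q v \<le> 2 * sqrt L * L2_set v {..<m}"
  proof (cases "L2_set v {..<m} = 0")
    case True
    then have "\<forall>j<m. v j = 0"
      by (subst (asm) L2_set_eq_0_iff) auto
    then have "q v = 0"
      by (simp add: q_def L2_set_def)
    with True show ?thesis by simp
  next
    case False
    define r where "r = L2_set v {..<m}"
    have r: "r > 0"
      unfolding r_def by (rule order.not_eq_order_implies_strict[OF False[symmetric] L2_set_nonneg])
    have "L2_set (\<lambda>j. (1 / r) * v j) {..<m} = 1"
      using r L2_set_right_distrib[of "1 / r" v "{..<m}"] by (simp add: r_def)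
    then have "q (\<lambda>j. (1 / r) * v j) \<le> S"
      by (intro S_upper) (simp add: U_def)
    then have "q v / r \<le> 2 * sqrt L"
      using S r q_scale[where c = "1 / r" and v = v] by simp
    then show ?thesis
      using r by (simp add: r_def field_simps)
  qed
  then have "(q v)\<^sup>2 \<le> (2 * sqrt L * L2_set v {..<m})\<^sup>2"
    by (intro power_mono) (auto simp: q_def L2_set_nonneg)
  then show ?thesis
    using L0 by (simp add: q_def L2_set_def power_mult_distrib sum_nonneg)
qed

section \<open>Orlicz norms and exponential tails\<close>

text \<open>Strictness provides an admissible scale below \<open>s\<close>, and the integrand
  decreases in the scale. The infimum itself need not be admissible: it is 0 if f vanishes almost
  everywhere.\<close>

lemma psi2_norm_lessD:
  assumes "psi2_norm P f < ennreal s"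
  shows "(\<integral>\<^sup>+x. ennreal (exp ((f x / s)\<^sup>2)) \<partial>P) \<le> 2"
proof -
  obtain s' where s': "s' > 0" "(\<integral>\<^sup>+x. ennreal (exp ((f x / s')\<^sup>2)) \<partial>P) \<le> 2" "ennreal s' < ennreal s"
    using assms unfolding psi2_norm_def Inf_less_iff by auto
  then have "s' < s"
    by (simp add: ennreal_less_iff)
  have "(\<integral>\<^sup>+x. ennreal (exp ((f x / s)\<^sup>2)) \<partial>P) \<le> (\<integral>\<^sup>+x. ennreal (exp ((f x / s')\<^sup>2)) \<partial>P)"
  proof (intro nn_integral_mono ennreal_leI)
    fix x
    have "\<bar>f x / s\<bar> \<le> \<bar>f x / s'\<bar>"
      using \<open>s' < s\<close> \<open>s' > 0\<close> by (simp add: abs_divide divide_left_mono)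
    then show "exp ((f x / s)\<^sup>2) \<le> exp ((f x / s')\<^sup>2)"
      by (simp add: abs_le_square_iff del: abs_divide)
  qed
  with s'(2) show ?thesis
    by (rule order.trans[rotated])
qed

text \<open>Net vectors lie inside the ball, not on the sphere over which the norm is taken;
  shrinking a unit direction only lowers the exponent.\<close>

lemma subgaussian_norm_lessD:
  assumes "prob_space P" and "subgaussian_norm m P < ennreal s" and w: "(\<Sum>j<m. (w j)\<^sup>2) \<le> 1"
  shows "(\<integral>\<^sup>+x. ennreal (exp (((\<Sum>j<m. (x j - mean_point m P j) * w j) / s)\<^sup>2)) \<partial>P) \<le> 2"
proof -
  interpret prob_space P by fact
  define r where "r = L2_set w {..<m}"
  have r: "0 \<le> r" "r \<le> 1"
    using w by (simp_all add: r_def L2_set_nonneg) (simp add: L2_set_def)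
  show ?thesis
  proof (cases "r = 0")
    case True
    then have "\<forall>j\<in>{..<m}. w j = 0"
      by (simp add: r_def L2_set_eq_0_iff)
    then have "(\<Sum>j<m. (x j - mean_point m P j) * w j) = 0" for x
      by (intro sum.neutral) auto
    then show ?thesis
      by (simp add: emeasure_space_1)
  next
    case False
    define u where "u = (\<lambda>j. w j / r)"
    have "L2_set (\<lambda>j. (1 / r) * w j) {..<m} = 1"
      using r False L2_set_right_distrib[of "1 / r" w "{..<m}"] by (simp add: r_def)
    then have "psi2_norm P (\<lambda>x. \<Sum>j<m. u j * (x j - mean_point m P j)) \<le> subgaussian_norm m P"
      unfolding subgaussian_norm_def by (intro SUP_upper) (simp add: u_def)
    then have *: "(\<integral>\<^sup>+x. ennreal (exp (((\<Sum>j<m. u j * (x j - mean_point m P j)) / s)\<^sup>2)) \<partial>P) \<le> 2"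
      using assms(2) by (intro psi2_norm_lessD) (rule order.strict_trans1)
    have "(\<integral>\<^sup>+x. ennreal (exp (((\<Sum>j<m. (x j - mean_point m P j) * w j) / s)\<^sup>2)) \<partial>P) \<le>
        (\<integral>\<^sup>+x. ennreal (exp (((\<Sum>j<m. u j * (x j - mean_point m P j)) / s)\<^sup>2)) \<partial>P)"
    proof (intro nn_integral_mono ennreal_leI)
      fix x
      have "((\<Sum>j<m. (x j - mean_point m P j) * w j) / s)\<^sup>2 = r\<^sup>2 * ((\<Sum>j<m. u j * (x j - mean_point m P j)) / s)\<^sup>2"
        using False unfolding power_mult_distrib[symmetric] times_divide_eq_right sum_distrib_left
        by (simp add: u_def mult.commute)
      moreover have "r\<^sup>2 * ((\<Sum>j<m. u j * (x j - mean_point m P j)) / s)\<^sup>2 \<le>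
          1 * ((\<Sum>j<m. u j * (x j - mean_point m P j)) / s)\<^sup>2"
        using r by (intro mult_right_mono) (auto simp: power_le_one)
      ultimately show "exp (((\<Sum>j<m. (x j - mean_point m P j) * w j) / s)\<^sup>2) \<le>
          exp (((\<Sum>j<m. u j * (x j - mean_point m P j)) / s)\<^sup>2)"
        by (simp only: exp_le_cancel_iff mult_1)
    qed
    then show ?thesis
      using * by (rule order.trans)
  qed
qed

text \<open>Markov's inequality for exp(sum / s^2), whose expectation is at most 2^N by
  independence: threshold 3N gives exp(-3N) 2^N <= exp(-2N).\<close>

lemma sum_squares_tail:
  fixes M :: "nat \<Rightarrow> 'a measure" and f :: "nat \<Rightarrow> 'a \<Rightarrow> real"
  assumes M: "\<And>i. i < N \<Longrightarrow> prob_space (M i)"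
    and f [measurable]: "\<And>i. i < N \<Longrightarrow> f i \<in> borel_measurable (M i)"
    and int: "\<And>i. i < N \<Longrightarrow> (\<integral>\<^sup>+x. ennreal (exp ((f i x / s)\<^sup>2)) \<partial>M i) \<le> 2"
    and "s > 0"
  shows "measure (PiM {..<N} M) {x \<in> space (PiM {..<N} M). 3 * real N * s\<^sup>2 < (\<Sum>i<N. (f i (x i))\<^sup>2)}
    \<le> exp (- 2 * real N)"
proof -
  \<comment> \<open>The product locale asks for a probability measure at every index, so indices
    outside the sample receive a point mass.\<close>
  define M' where "M' = (\<lambda>i. if i < N then M i else return (count_space UNIV) undefined)"
  have PiM: "PiM {..<N} M = PiM {..<N} M'"
    by (rule PiM_cong) (auto simp: M'_def)
  have "prob_space (M' i)" for i
    by (auto simp: M'_def M intro: prob_space_return)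
  then interpret product_prob_space M' "{..<N}"
    by (rule product_prob_spaceI)
  let ?Q = "PiM {..<N} M'"
  have f' [measurable]: "(\<lambda>x. f i (x i)) \<in> borel_measurable ?Q" if "i < N" for i
    using f[OF that] that
    by (intro measurable_compose[OF measurable_component_singleton[of i]]) (auto simp: M'_def)
  define g where "g = (\<lambda>x. \<Prod>i<N. ennreal (exp ((f i (x i) / s)\<^sup>2)))"
  have g_meas [measurable]: "g \<in> borel_measurable ?Q"
    unfolding g_def by measurable
  have g_eq: "g x = ennreal (exp ((\<Sum>i<N. (f i (x i))\<^sup>2) / s\<^sup>2))" for x
    by (simp add: g_def prod_ennreal exp_sum power_divide sum_divide_distrib)
  have "(\<integral>\<^sup>+x. g x \<partial>?Q) = (\<Prod>i<N. \<integral>\<^sup>+x. ennreal (exp ((f i x / s)\<^sup>2)) \<partial>M' i)"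
    unfolding g_def using f by (intro product_nn_integral_prod) (auto simp: M'_def)
  also have "\<dots> \<le> (\<Prod>i<N. 2)"
    using int by (intro prod_mono_ennreal) (auto simp: M'_def)
  finally have "(\<integral>\<^sup>+x. g x \<partial>?Q) \<le> 2 ^ N"
    by simp
  let ?A = "{x \<in> space ?Q. 3 * real N * s\<^sup>2 < (\<Sum>i<N. (f i (x i))\<^sup>2)}"
  have "emeasure ?Q ?A \<le> emeasure ?Q {x \<in> space ?Q. 1 \<le> ennreal (exp (- 3 * real N)) * g x}"
  proof (rule emeasure_mono)
    show "?A \<subseteq> {x \<in> space ?Q. 1 \<le> ennreal (exp (- 3 * real N)) * g x}"
    proof safe
      fix x assume "3 * real N * s\<^sup>2 < (\<Sum>i<N. (f i (x i))\<^sup>2)"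
      then have "3 * real N \<le> (\<Sum>i<N. (f i (x i))\<^sup>2) / s\<^sup>2"
        using \<open>s > 0\<close> by (simp add: field_simps)
      then show "1 \<le> ennreal (exp (- 3 * real N)) * g x"
        by (simp add: g_eq flip: ennreal_mult exp_add)
    qed
  qed measurable
  also have "\<dots> \<le> ennreal (exp (- 3 * real N)) * (\<integral>\<^sup>+x. g x * indicator (space ?Q) x \<partial>?Q)"
    using nn_integral_Markov_inequality[where u = g and M = ?Q and A = "space ?Q" and c = "ennreal (exp (- 3 * real N))"] by simp
  also have "(\<integral>\<^sup>+x. g x * indicator (space ?Q) x \<partial>?Q) = (\<integral>\<^sup>+x. g x \<partial>?Q)"
    by (intro nn_integral_cong) simp
  also have "ennreal (exp (- 3 * real N)) * (\<integral>\<^sup>+x. g x \<partial>?Q) \<le> ennreal (exp (- 3 * real N)) * 2 ^ N"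
    by (intro mult_left_mono) (use \<open>(\<integral>\<^sup>+x. g x \<partial>?Q) \<le> 2 ^ N\<close> in auto)
  also have "\<dots> = ennreal (exp (- 3 * real N) * 2 ^ N)"
    by (simp add: ennreal_mult ennreal_power flip: ennreal_numeral)
  also have "\<dots> \<le> ennreal (exp (- 2 * real N))"
  proof (rule ennreal_leI)
    have "(2::real) ^ N \<le> exp 1 ^ N"
      using exp_ge_add_one_self[of 1] by (intro power_mono) auto
    also have "exp (1 :: real) ^ N = exp (real N)"
      by (simp flip: exp_of_nat_mult)
    finally have "exp (- 3 * real N) * 2 ^ N \<le> exp (- 3 * real N) * exp (real N)"
      by simp
    then show "exp (- 3 * real N) * 2 ^ N \<le> exp (- 2 * real N)"
      by (simp flip: exp_add)
  qed
  finally show ?thesis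
    unfolding PiM by (simp add: emeasure_eq_measure)
qed

text \<open>Union bound over the net. The constant 12 is 3 from the tail bound times 4 from passing
  from the net to all vectors, which makes one event serve every \<open>v\<close>.\<close>

lemma subgaussian_sample_opnorm:
  fixes P :: "nat \<Rightarrow> point measure"
  assumes lab: "\<And>i. i < N \<Longrightarrow> lab i < k"
    and P: "\<And>t. t < k \<Longrightarrow> subgaussian_distribution m (P t)"
    and "s\<^sub>0 \<ge> 0"
    and norm: "\<And>t s. t < k \<Longrightarrow> s\<^sub>0 < s \<Longrightarrow> subgaussian_norm m (P t) < ennreal s"
    and N: "6 * real m \<le> real N"
  shows "\<exists>E\<in>sets (sample N lab P). measure (sample N lab P) E \<ge> 1 - exp (- real N) \<and>
    (\<forall>x\<in>E. \<forall>v. (\<Sum>i<N. (\<Sum>l<m. (x i l - mean_point m (P (lab i)) l) * v l)\<^sup>2) \<le>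
      12 * real N * s\<^sub>0\<^sup>2 * (\<Sum>l<m. (v l)\<^sup>2))"
proof -
  let ?S = "sample N lab P"
  define q where "q = (\<lambda>w x. \<Sum>i<N. (\<Sum>l<m. (x i l - mean_point m (P (lab i)) l) * w l)\<^sup>2)"
  define E where "E = (\<lambda>s. {x \<in> space ?S. \<forall>w\<in>net m. q w x \<le> 3 * real N * s\<^sup>2})"
  have prob: "prob_space (P (lab i))" and sets: "sets (P (lab i)) = sets (Rn m)" if "i < N" for i
    using P[OF lab[OF that]] by (auto simp: subgaussian_distribution_def)
  define P' where "P' = (\<lambda>i. if i < N then P (lab i) else return (count_space UNIV) undefined)"
  have "?S = PiM {..<N} P'"
    unfolding sample_def by (rule PiM_cong) (auto simp: P'_def)
  moreover have "prob_space (PiM {..<N} P')"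
    by (rule prob_space_PiM) (auto simp: P'_def prob prob_space_return)
  ultimately interpret S: prob_space ?S
    by simp
  have marginal: "(\<lambda>x. \<Sum>l<m. (x l - mean_point m (P (lab i)) l) * w l) \<in> borel_measurable (P (lab i))"
    if "i < N" for w i
    by (subst measurable_cong_sets[OF sets[OF that] refl]) measurable
  have "(\<lambda>x. \<Sum>l<m. (x i l - mean_point m (P (lab i)) l) * w l) \<in> borel_measurable ?S" if "i < N" for w i
    unfolding sample_def
    using that by (intro measurable_compose[OF measurable_component_singleton[of i] marginal]) auto
  then have q_meas [measurable]: "q w \<in> borel_measurable ?S" for w
    unfolding q_def by (intro borel_measurable_sum[of "{..<N}"] borel_measurable_power) (simp only: lessThan_iff)
  have E_sets [measurable]: "E s \<in> sets ?S" for s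
    unfolding E_def using finite_net[of m] by measurable
  have E_mono: "E s \<subseteq> E s'" if "0 \<le> s" "s \<le> s'" for s s'
  proof -
    have "3 * real N * s\<^sup>2 \<le> 3 * real N * s'\<^sup>2"
      using that by (intro mult_left_mono power_mono) auto
    then show ?thesis
      unfolding E_def by (blast intro: order.trans)
  qed
  have bound: "measure ?S (E s) \<ge> 1 - exp (- real N)" if "s\<^sub>0 < s" for s
  proof -
    have "s > 0"
      using that \<open>s\<^sub>0 \<ge> 0\<close> by simp
    have tail: "measure ?S {x \<in> space ?S. 3 * real N * s\<^sup>2 < q w x} \<le> exp (- 2 * real N)" if "w \<in> net m" for w
      unfolding q_def sample_def
      by (rule sum_squares_tail[where f = "\<lambda>i x. \<Sum>l<m. (x l - mean_point m (P (lab i)) l) * w l"])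
         (auto simp: prob marginal \<open>s > 0\<close>
           intro!: subgaussian_norm_lessD net_sum_squares_le_1 that norm lab \<open>s\<^sub>0 < s\<close>)
    have "space ?S - E s = (\<Union>w\<in>net m. {x \<in> space ?S. 3 * real N * s\<^sup>2 < q w x})"
      by (auto simp: E_def not_le)
    then have "measure ?S (space ?S - E s) \<le> (\<Sum>w\<in>net m. measure ?S {x \<in> space ?S. 3 * real N * s\<^sup>2 < q w x})"
      by (simp only:) (intro S.finite_measure_subadditive_finite finite_net image_subsetI; measurable)
    also have "\<dots> \<le> (\<Sum>w\<in>net m. exp (- 2 * real N))"
      by (intro sum_mono tail)
    also have "\<dots> \<le> exp (6 * real m) * exp (- 2 * real N)"
      using card_net_le[of m] by (simp add: mult_right_mono)
    \<comment> \<open>This is where N >= 6m enters: the entropy exp(6m) of the net uses up half of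
      the tail exponent 2N.\<close>
    also have "\<dots> \<le> exp (- real N)"
      using N by (simp flip: exp_add)
    finally show ?thesis
      using S.prob_compl[OF E_sets[of s]] by simp
  qed
  (* The Chernoff bound needs a scale s > s0; s0 itself, which may be 0, is reached in the limit. *)
  define A where "A = (\<lambda>n. E (s\<^sub>0 + 1 / real (Suc n)))"
  have A_eq: "(\<Inter>n. A n) = E s\<^sub>0"
  proof (intro equalityI subsetI)
    fix x assume x: "x \<in> (\<Inter>n. A n)"
    have "q w x \<le> 3 * real N * s\<^sub>0\<^sup>2" if "w \<in> net m" for w
    proof (rule LIMSEQ_le_const)
      have "(\<lambda>n. 3 * real N * (s\<^sub>0 + 1 / real (Suc n))\<^sup>2) \<longlonglongrightarrow> 3 * real N * (s\<^sub>0 + 0)\<^sup>2"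
        by (intro tendsto_intros LIMSEQ_Suc[OF lim_1_over_n])
      then show "(\<lambda>n. 3 * real N * (s\<^sub>0 + 1 / real (Suc n))\<^sup>2) \<longlonglongrightarrow> 3 * real N * s\<^sub>0\<^sup>2"
        by simp
      show "\<exists>n0. \<forall>n\<ge>n0. q w x \<le> 3 * real N * (s\<^sub>0 + 1 / real (Suc n))\<^sup>2"
        using x that unfolding A_def E_def by blast
    qed
    then show "x \<in> E s\<^sub>0"
      using x by (auto simp: A_def E_def)
  next
    fix x assume "x \<in> E s\<^sub>0"
    then show "x \<in> (\<Inter>n. A n)"
      using E_mono[OF \<open>s\<^sub>0 \<ge> 0\<close>] unfolding A_def by (intro INT_I) (auto intro: subsetD[OF E_mono[OF \<open>s\<^sub>0 \<ge> 0\<close>]])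
  qed
  have "decseq A"
  proof (rule decseq_SucI)
    fix n
    have "1 / real (Suc (Suc n)) \<le> 1 / real (Suc n)"
      by (simp add: field_simps)
    then show "A (Suc n) \<subseteq> A n"
      using \<open>s\<^sub>0 \<ge> 0\<close> unfolding A_def by (intro E_mono) auto
  qed
  \<comment> \<open>Continuity from above: the probability bound does not depend on the scale, so it
    survives the limit.\<close>
  then have "(\<lambda>n. measure ?S (A n)) \<longlonglongrightarrow> measure ?S (E s\<^sub>0)"
    unfolding A_eq[symmetric] by (intro S.finite_Lim_measure_decseq) (auto simp: A_def)
  then have "measure ?S (E s\<^sub>0) \<ge> 1 - exp (- real N)"
    by (rule LIMSEQ_le_const) (auto simp: A_def intro!: bound)
  moreover have "(\<Sum>i<N. (\<Sum>l<m. (x i l - mean_point m (P (lab i)) l) * v l)\<^sup>2) \<le>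
      12 * real N * s\<^sub>0\<^sup>2 * (\<Sum>l<m. (v l)\<^sup>2)" if "x \<in> E s\<^sub>0" for x v
    using opnorm_le_net[where m = m and N = N and a = "\<lambda>i l. x i l - mean_point m (P (lab i)) l"
        and L = "3 * real N * s\<^sub>0\<^sup>2" and v = v] that
    by (simp add: E_def q_def)
  ultimately show ?thesis
    using E_sets by blast
qed

subsection \<open>The k-means semidefinite program\<close>

lemma mat_trace_mult:
  assumes "A \<in> carrier_mat N N" "B \<in> carrier_mat N N"
  shows "mat_trace (A * B) = (\<Sum>i<N. \<Sum>j<N. A $$ (i, j) * B $$ (j, i))"
  using assms by (auto simp: mat_trace_def scalar_prod_def lessThan_atLeast0 intro!: sum.cong)

text \<open>Bridge between matrices and index functions; the quadratic form sees only the
  coordinates below \<open>N\<close>, so vectors and arbitrary functions test the same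
  condition.\<close>

lemma sdp_feasible_iff:
  assumes "X \<in> carrier_mat N N"
  shows "sdp_feasible k N X \<longleftrightarrow>
    stochastic_psd N (\<lambda>i j. X $$ (i, j)) \<and> (\<Sum>i<N. X $$ (i, i)) = real k"
proof -
  have dim: "dim_row X = N" "dim_col X = N"
    using assms by auto
  have quad: "scalar_prod v (mult_mat_vec X v) = (\<Sum>i<N. \<Sum>j<N. v $ i * X $$ (i, j) * v $ j)"
    if "v \<in> carrier_vec N" for v
    using that dim by (auto simp: scalar_prod_def lessThan_atLeast0 sum_distrib_left mult.assoc intro!: sum.cong)
  have psd: "(\<forall>v\<in>carrier_vec N. scalar_prod v (mult_mat_vec X v) \<ge> 0) \<longleftrightarrow>
      (\<forall>v. 0 \<le> (\<Sum>i<N. \<Sum>j<N. v i * X $$ (i, j) * v j))"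
  proof (intro iffI allI ballI)
    fix v :: "nat \<Rightarrow> real"
    assume "\<forall>v\<in>carrier_vec N. scalar_prod v (mult_mat_vec X v) \<ge> 0"
    then have "scalar_prod (Matrix.vec N v) (mult_mat_vec X (Matrix.vec N v)) \<ge> 0"
      by simp
    then show "0 \<le> (\<Sum>i<N. \<Sum>j<N. v i * X $$ (i, j) * v j)"
      by (simp add: quad)
  qed (use quad in auto)
  have sym: "transpose_mat X = X \<longleftrightarrow> (\<forall>i<N. \<forall>j<N. X $$ (i, j) = X $$ (j, i))"
    using dim by (auto simp: mat_eq_iff)
  have row: "mult_mat_vec X (Matrix.vec N (\<lambda>_. 1)) = Matrix.vec N (\<lambda>_. 1) \<longleftrightarrow>
      (\<forall>i<N. (\<Sum>j<N. X $$ (i, j)) = 1)"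
    using dim by (auto simp: vec_eq_iff scalar_prod_def lessThan_atLeast0)
  show ?thesis
    using assms dim
    unfolding sdp_feasible_def pos_semidef_def stochastic_psd_def psd sym row mat_trace_def
    by auto
qed

lemma X_ref_index:
  assumes "i < N" "j < N" "lab i < k"
  shows "X_ref k N lab $$ (i, j) = of_bool (lab i = lab j) / real (cluster_size N lab (lab i))"
  using assms by (simp add: X_ref_def of_bool_def mult_delta_left mult_delta_right)

lemma sdp_feasible_X_ref:
  assumes lab: "\<And>i. i < N \<Longrightarrow> lab i < k" and size: "\<And>t. t < k \<Longrightarrow> cluster_size N lab t \<ge> 1"
  shows "sdp_feasible k N (X_ref k N lab)"
proof -
  let ?n = "cluster_size N lab" and ?R = "X_ref k N lab"
  have size_pos: "?n (lab i) \<noteq> 0" if "i < N" for i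
    using size[OF lab[OF that]] by simp
  have "stochastic_psd N (\<lambda>i j. ?R $$ (i, j))"
  proof
    fix v :: "nat \<Rightarrow> real"
    \<comment> \<open>The form is a sum over clusters of squared cluster sums divided by the
      sizes.\<close>
    have "(\<Sum>i<N. \<Sum>j<N. v i * ?R $$ (i, j) * v j) =
        (\<Sum>i<N. \<Sum>j<N. \<Sum>t<k. (v i * of_bool (lab i = t)) * (v j * of_bool (lab j = t)) / real (?n t))"
      by (intro sum.cong refl) (simp add: X_ref_def sum_distrib_left sum_distrib_right ac_simps)
    also have "\<dots> = (\<Sum>t<k. \<Sum>i<N. \<Sum>j<N. (v i * of_bool (lab i = t)) * (v j * of_bool (lab j = t)) / real (?n t))"
      by (subst sum.swap, subst (2) sum.swap, rule refl)
    also have "\<dots> = (\<Sum>t<k. (\<Sum>i<N. v i * of_bool (lab i = t))\<^sup>2 / real (?n t))"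
      by (simp only: power2_eq_square sum_product sum_divide_distrib)
    finally show "0 \<le> (\<Sum>i<N. \<Sum>j<N. v i * ?R $$ (i, j) * v j)"
      by (simp add: sum_nonneg)
  next
    fix i assume i: "i < N"
    have "(\<Sum>j<N. ?R $$ (i, j)) = (\<Sum>j<N. of_bool (lab i = lab j)) / real (?n (lab i))"
      unfolding sum_divide_distrib by (intro sum.cong refl X_ref_index lab i) auto
    then show "(\<Sum>j<N. ?R $$ (i, j)) = 1"
      using size_pos[OF i] by (simp add: sum_of_bool_lab del: sum_of_bool_eq)
  qed (auto simp: X_ref_index lab)
  moreover have "(\<Sum>i<N. ?R $$ (i, i)) = real k"
    using sum_inverse_cluster_size[OF lab size] by (simp add: X_ref_index lab)
  ultimately show ?thesis
    by (subst sdp_feasible_iff) (auto simp: X_ref_def)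
qed

section \<open>Center separation and cluster sizes\<close>

lemma delta_min_le:
  assumes "a < k" "b < k" "a \<noteq> b"
  shows "delta_min m k P \<le> eucl_dist m (mean_point m (P a)) (mean_point m (P b))"
  unfolding delta_min_def
proof (rule Min_le)
  show "finite {eucl_dist m (mean_point m (P a)) (mean_point m (P b)) |a b. a < k \<and> b < k \<and> a \<noteq> b}"
    by (rule finite_subset[of _ "(\<lambda>(a, b). eucl_dist m (mean_point m (P a)) (mean_point m (P b))) ` ({..<k} \<times> {..<k})"]) auto
qed (use assms in auto)

lemma eucl_dist_mean_point_pos:
  assumes "mean_point m P \<noteq> mean_point m Q"
  shows "eucl_dist m (mean_point m P) (mean_point m Q) > 0"
proof -
  obtain j where "j < m" "mean_point m P j \<noteq> mean_point m Q j"
    using assms by (auto simp: mean_point_def fun_eq_iff split: if_splits)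
  then have "eucl_dist m (mean_point m P) (mean_point m Q) \<noteq> 0"
    by (auto simp: eucl_dist_def L2_set_eq_0_iff)
  moreover have "eucl_dist m (mean_point m P) (mean_point m Q) \<ge> 0"
    by (simp add: eucl_dist_def)
  ultimately show ?thesis
    by simp
qed

text \<open>The two indices show that the minimum is over a nonempty set. The sign matters because
  the separation enters the estimates squared.\<close>

lemma delta_min_pos:
  assumes "a < k" "b < k" "a \<noteq> b" and "inj_on (\<lambda>t. mean_point m (P t)) {..<k}"
  shows "delta_min m k P > 0"
proof -
  let ?D = "{eucl_dist m (mean_point m (P a)) (mean_point m (P b)) |a b. a < k \<and> b < k \<and> a \<noteq> b}"
  have "finite ?D"
    by (rule finite_subset[of _ "(\<lambda>(a, b). eucl_dist m (mean_point m (P a)) (mean_point m (P b))) ` ({..<k} \<times> {..<k})"]) auto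
  moreover have "?D \<noteq> {}"
    using assms(1-3) by auto
  moreover have "\<forall>d\<in>?D. 0 < d"
    using assms(4) by (auto intro!: eucl_dist_mean_point_pos dest: inj_onD)
  ultimately show ?thesis
    unfolding delta_min_def using Min_in by blast
qed

lemma cluster_size_bounds:
  assumes "t < k"
  shows "n_min k N lab \<le> cluster_size N lab t" "cluster_size N lab t \<le> n_max k N lab"
  using assms by (auto simp: n_min_def n_max_def)

lemma n_min_pos:
  assumes "k \<ge> 1" and "\<And>t. t < k \<Longrightarrow> cluster_size N lab t \<ge> 1"
  shows "n_min k N lab > 0"
proof -
  have "cluster_size N lab ` {..<k} \<noteq> {}"
    using assms(1) by (auto simp: lessThan_empty_iff)
  then have "n_min k N lab \<in> cluster_size N lab ` {..<k}"
    unfolding n_min_def by (intro Min_in) auto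
  then show ?thesis
    using assms(2) by fastforce
qed

lemma sample_size_le:
  assumes "\<And>i. i < N \<Longrightarrow> lab i < k"
  shows "N \<le> k * n_max k N lab"
proof -
  have "N = (\<Sum>i<N. 1)"
    by simp
  also have "\<dots> = (\<Sum>t<k. \<Sum>i | i \<in> {..<N} \<and> lab i = t. 1)"
    using assms by (intro sum.group[symmetric]) auto
  also have "\<dots> = (\<Sum>t<k. cluster_size N lab t)"
    by (simp add: cluster_size_def)
  also have "\<dots> \<le> (\<Sum>t<k. n_max k N lab)"
    using cluster_size_bounds by (intro sum_mono) auto
  finally show ?thesis
    by simp
qed

section \<open>From the noise bound to recovery of the clusters\<close>

text \<open>Here \<open>w\<close> is the mass outside the blocks. The product form of the second
  conclusion avoids dividing by the separation; for one cluster the separation is unspecified, but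
  then \<open>w\<close> is 0, which the third conclusion records.\<close>

lemma sdp_minimizer_off_mass:
  assumes mix: "subgaussian_mixture m k N lab P"
    and min: "sdp_minimizer k N (dist_mat m N x) X"
    and "L \<ge> 0"
    and opnorm: "\<And>v. (\<Sum>i<N. (\<Sum>l<m. (x i l - mean_point m (P (lab i)) l) * v l)\<^sup>2) \<le>
      L * (\<Sum>l<m. (v l)\<^sup>2)"
  obtains w where "0 \<le> w" and "(delta_min m k P)\<^sup>2 * w \<le> 12 * real k * L"
    and "w \<noteq> 0 \<Longrightarrow> delta_min m k P > 0"
    and "(frobenius_norm (X - X_ref k N lab))\<^sup>2 \<le> 2 * w / real (n_min k N lab)"
proof -
  have lab: "lab i < k" if "i < N" for i
    using mix that by (auto simp: subgaussian_mixture_def)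
  have size: "cluster_size N lab t \<ge> 1" if "t < k" for t
    using mix that by (auto simp: subgaussian_mixture_def)
  have k: "k \<ge> 1" and inj: "inj_on (\<lambda>t. mean_point m (P t)) {..<k}"
    using mix by (auto simp: subgaussian_mixture_def)
  let ?R = "X_ref k N lab"
  have R_feas: "sdp_feasible k N ?R"
    using lab size by (rule sdp_feasible_X_ref)
  have X_feas: "sdp_feasible k N X" and opt: "mat_trace (dist_mat m N x * X) \<le> mat_trace (dist_mat m N x * ?R)"
    using min R_feas by (auto simp: sdp_minimizer_def)
  have carrier: "X \<in> carrier_mat N N" "?R \<in> carrier_mat N N" "dist_mat m N x \<in> carrier_mat N N"
    using X_feas R_feas by (auto simp: sdp_feasible_def dist_mat_def)
  have X: "stochastic_psd N (\<lambda>i j. X $$ (i, j))" and trace: "(\<Sum>i<N. X $$ (i, i)) = real k"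
    using X_feas carrier by (simp_all add: sdp_feasible_iff)
  have R: "stochastic_psd N (\<lambda>i j. ?R $$ (i, j))"
    using R_feas carrier by (simp add: sdp_feasible_iff)
  interpret X: stochastic_psd N "\<lambda>i j. X $$ (i, j)" by fact
  have objective: "mat_trace (dist_mat m N x * Y) = (\<Sum>i<N. \<Sum>j<N. Y $$ (i, j) * (\<Sum>l<m. (x i l - x j l)\<^sup>2))"
    if "Y \<in> carrier_mat N N" "stochastic_psd N (\<lambda>i j. Y $$ (i, j))" for Y
    unfolding mat_trace_mult[OF carrier(3) that(1)] using stochastic_psd.sym[OF that(2)]
    by (auto simp: dist_mat_def eucl_dist_def L2_set_def sum_nonneg mult.commute intro!: sum.cong)
  define w where "w = (\<Sum>i<N. \<Sum>j<N. X $$ (i, j) * of_bool (lab i \<noteq> lab j))"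
  show thesis
  proof
    show "0 \<le> w"
      unfolding w_def by (intro sum_nonneg mult_nonneg_nonneg X.nonneg) auto
    have distinct: "delta_min m k P > 0" if "i < N" "j < N" "lab i \<noteq> lab j" for i j
      by (rule delta_min_pos[OF lab[OF that(1)] lab[OF that(2)] that(3) inj])
    show "delta_min m k P > 0" if "w \<noteq> 0"
    proof (rule ccontr)
      assume "\<not> delta_min m k P > 0"
      then have "X $$ (i, j) * of_bool (lab i \<noteq> lab j) = 0" if "i < N" "j < N" for i j
        using distinct[OF that] by auto
      then have "w = 0"
        unfolding w_def by (intro sum.neutral ballI) (use lessThan_iff in blast)
      with that show False ..
    qed
    have "(delta_min m k P)\<^sup>2 * w =
        (\<Sum>i<N. \<Sum>j<N. X $$ (i, j) * ((delta_min m k P)\<^sup>2 * of_bool (lab i \<noteq> lab j)))"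
      unfolding w_def sum_distrib_left by (intro sum.cong refl mult.left_commute)
    also have "\<dots> \<le> (\<Sum>i<N. \<Sum>j<N. X $$ (i, j) *
        (\<Sum>l<m. (mean_point m (P (lab i)) l - mean_point m (P (lab j)) l)\<^sup>2))"
    proof (intro sum_mono mult_left_mono X.nonneg)
      fix i j assume ij: "i \<in> {..<N}" "j \<in> {..<N}"
      let ?d = "\<Sum>l<m. (mean_point m (P (lab i)) l - mean_point m (P (lab j)) l)\<^sup>2"
      show "(delta_min m k P)\<^sup>2 * of_bool (lab i \<noteq> lab j) \<le> ?d"
      proof (cases "lab i = lab j")
        case False
        have "(delta_min m k P)\<^sup>2 \<le> (eucl_dist m (mean_point m (P (lab i))) (mean_point m (P (lab j))))\<^sup>2"
          using ij False distinct[of i j] delta_min_le[OF lab lab, of i j] by (intro power_mono) auto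
        then show ?thesis
          using False by (simp add: eucl_dist_def L2_set_def sum_nonneg)
      qed (simp add: sum_nonneg)
    qed auto
    also have "\<dots> \<le> 12 * real k * L"
    proof (rule kmeans_sdp_separation[OF X R lab _ trace _ \<open>L \<ge> 0\<close> opnorm])
      show "?R $$ (i, j) = 0" if "i < N" "j < N" "lab i \<noteq> lab j" for i j
        using that lab by (simp add: X_ref_index)
      show "(\<Sum>i<N. \<Sum>j<N. X $$ (i, j) * (\<Sum>l<m. (x i l - x j l)\<^sup>2)) \<le>
          (\<Sum>i<N. \<Sum>j<N. ?R $$ (i, j) * (\<Sum>l<m. (x i l - x j l)\<^sup>2))"
        using opt objective[OF carrier(1) X] objective[OF carrier(2) R] by simp
    qed
    finally show "(delta_min m k P)\<^sup>2 * w \<le> 12 * real k * L" .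
    have "n_min k N lab > 0"
      using k size by (rule n_min_pos)
    then have "(\<Sum>i<N. \<Sum>j<N. (X $$ (i, j) - of_bool (lab i = lab j) / real (cluster_size N lab (lab i)))\<^sup>2) \<le>
        2 * w / real (n_min k N lab)"
      unfolding w_def using cluster_size_bounds by (intro frobenius_block_deviation[OF X lab]) (auto simp: trace)
    moreover have "(frobenius_norm (X - ?R))\<^sup>2 =
        (\<Sum>i<N. \<Sum>j<N. (X $$ (i, j) - of_bool (lab i = lab j) / real (cluster_size N lab (lab i)))\<^sup>2)"
    proof -
      have "(frobenius_norm (X - ?R))\<^sup>2 = (\<Sum>i<N. \<Sum>j<N. (X $$ (i, j) - ?R $$ (i, j))\<^sup>2)"
        using carrier by (simp add: frobenius_norm_def sum_nonneg)
      then show ?thesis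
        by (simp add: X_ref_index lab)
    qed
    ultimately show "(frobenius_norm (X - ?R))\<^sup>2 \<le> 2 * w / real (n_min k N lab)"
      by simp
  qed
qed

theorem theorem2:
  fixes K A B :: real
  assumes "K > 0" and "A > 0" and "B > 0"
  shows "\<exists>C c1 c2 c3 :: real. C > 0 \<and> c1 > 0 \<and> c2 > 0 \<and> c3 > 0 \<and>
    (\<forall>(\<epsilon> :: real) (\<eta> :: real) (m :: nat) (k :: nat) (N :: nat)
       (lab :: nat \<Rightarrow> nat) (P :: nat \<Rightarrow> point measure).
      \<epsilon> > 0 \<longrightarrow> \<eta> > 0 \<longrightarrow>
      subgaussian_mixture m k N lab P \<longrightarrow>
      (\<forall>t<k. subgaussian_norm m (P t) \<le> ennreal (K * sigma_max m k P)) \<longrightarrow>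
      imbalance k N lab \<le> A * real k \<longrightarrow>
      real k \<le> B * real m \<longrightarrow>
      real N > Max {c1 * real m, c2 * ln (2 / \<eta>), ln (c3 / \<eta>)} \<longrightarrow>
      (delta_min m k P)\<^sup>2
        \<ge> C / \<epsilon> * (real k)\<^sup>2 * imbalance k N lab * (sigma_max m k P)\<^sup>2 \<longrightarrow>
      (\<exists>E \<in> sets (sample N lab P).
         measure (sample N lab P) E \<ge> 1 - 2 * \<eta> \<and>
         (\<forall>x\<in>E. \<forall>X. sdp_minimizer k N (dist_mat m N x) X \<longrightarrow>
            (frobenius_norm (X - X_ref k N lab))\<^sup>2 \<le> \<epsilon>)))"
\<comment> \<open>288 = 2 * 12 * 12: the Frobenius bound 2w / n_min, the separation bound 12kL, and
  L = 12 N s^2; then N <= k n_max = k alpha n_min gives k^2 alpha. The 6 is the entropy exponent of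
  the net, and the last 1 makes exp(-N) at most eta.\<close>
proof (rule exI[of _ "288 * K\<^sup>2"], rule exI[of _ 6], rule exI[of _ 1], rule exI[of _ 1], intro conjI allI impI)
  fix \<epsilon> \<eta> :: real and m k N :: nat and lab :: "nat \<Rightarrow> nat" and P :: "nat \<Rightarrow> point measure"
  assume "\<epsilon> > 0" "\<eta> > 0"
    and mix: "subgaussian_mixture m k N lab P"
    and norm: "\<forall>t<k. subgaussian_norm m (P t) \<le> ennreal (K * sigma_max m k P)"
    and N: "real N > Max {6 * real m, 1 * ln (2 / \<eta>), ln (1 / \<eta>)}"
    and sep: "(delta_min m k P)\<^sup>2 \<ge> 288 * K\<^sup>2 / \<epsilon> * (real k)\<^sup>2 * imbalance k N lab * (sigma_max m k P)\<^sup>2"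
  let ?\<sigma> = "sigma_max m k P" and ?\<alpha> = "imbalance k N lab" and ?b = "n_min k N lab"
  have lab: "lab i < k" if "i < N" for i
    using mix that by (auto simp: subgaussian_mixture_def)
  have size: "cluster_size N lab t \<ge> 1" if "t < k" for t
    using mix that by (auto simp: subgaussian_mixture_def)
  have k: "k \<ge> 1"
    using mix by (auto simp: subgaussian_mixture_def)
  have b: "?b > 0"
    using k size by (rule n_min_pos)
  have "n_max k N lab > 0"
    using size[of 0] cluster_size_bounds(2)[of 0 k N lab] k by linarith
  then have \<alpha>: "?\<alpha> > 0" "real (n_max k N lab) = ?\<alpha> * real ?b"
    using b by (auto simp: imbalance_def)
  have N_le: "real N \<le> real k * (?\<alpha> * real ?b)"
    using sample_size_le[of N lab k] lab unfolding \<alpha>(2)[symmetric] by (simp flip: of_nat_mult)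
  have prob: "exp (- real N) \<le> 2 * \<eta>"
  proof -
    have "ln (1 / \<eta>) \<le> Max {6 * real m, 1 * ln (2 / \<eta>), ln (1 / \<eta>)}"
      by (intro Max_ge) auto
    then have "- real N \<le> ln \<eta>"
      using N \<open>\<eta> > 0\<close> by (simp add: ln_div del: Max_insert)
    then have "exp (- real N) \<le> exp (ln \<eta>)"
      by (simp only: exp_le_cancel_iff)
    then show ?thesis
      using \<open>\<eta> > 0\<close> by simp
  qed
  \<comment> \<open>\<open>ennreal\<close> truncates negative reals to 0, and so does
    \<open>s\<close>; thus the sign of \<open>sigma_max\<close>, a root of a maximum over spectra,
    need not be settled.\<close>
  define s where "s = max 0 (K * ?\<sigma>)"
  have s: "s \<ge> 0" "s\<^sup>2 \<le> K\<^sup>2 * ?\<sigma>\<^sup>2"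
    by (auto simp: s_def max_def power_mult_distrib)
  obtain E where E: "E \<in> sets (sample N lab P)" "measure (sample N lab P) E \<ge> 1 - exp (- real N)"
    and op: "\<And>x v. x \<in> E \<Longrightarrow> (\<Sum>i<N. (\<Sum>l<m. (x i l - mean_point m (P (lab i)) l) * v l)\<^sup>2) \<le>
      12 * real N * s\<^sup>2 * (\<Sum>l<m. (v l)\<^sup>2)"
  proof -
    have "subgaussian_norm m (P t) < ennreal s'" if "t < k" "s < s'" for t s'
    proof -
      have "subgaussian_norm m (P t) \<le> ennreal (K * ?\<sigma>)"
        using norm that by simp
      also have "\<dots> < ennreal s'"
        using that by (intro ennreal_lessI) (auto simp: s_def)
      finally show ?thesis .
    qed
    then have "\<exists>E\<in>sets (sample N lab P). measure (sample N lab P) E \<ge> 1 - exp (- real N) \<and>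
      (\<forall>x\<in>E. \<forall>v. (\<Sum>i<N. (\<Sum>l<m. (x i l - mean_point m (P (lab i)) l) * v l)\<^sup>2) \<le>
        12 * real N * s\<^sup>2 * (\<Sum>l<m. (v l)\<^sup>2))"
      using mix N s(1) by (intro subgaussian_sample_opnorm[OF lab]) (auto simp: subgaussian_mixture_def)
    then show ?thesis
      using that by blast
  qed
  have "(frobenius_norm (X - X_ref k N lab))\<^sup>2 \<le> \<epsilon>"
    if x: "x \<in> E" and X: "sdp_minimizer k N (dist_mat m N x) X" for x X
  proof -
    obtain w where w: "0 \<le> w" "(delta_min m k P)\<^sup>2 * w \<le> 12 * real k * (12 * real N * s\<^sup>2)"
        "w \<noteq> 0 \<Longrightarrow> delta_min m k P > 0"
      and frob: "(frobenius_norm (X - X_ref k N lab))\<^sup>2 \<le> 2 * w / real ?b"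
      using sdp_minimizer_off_mass[OF mix X _ op[OF x]] by auto
    have "2 * w / real ?b \<le> \<epsilon>"
    proof (cases "w = 0")
      case True
      then show ?thesis
        using \<open>\<epsilon> > 0\<close> by simp
    next
      case False
      \<comment> \<open>Without noise the product of squared separation and \<open>w\<close> is at
        most 0, so a positive separation, which rests on distinct means, excludes off-block
        mass.\<close>
      have "?\<sigma> \<noteq> 0"
      proof
        assume "?\<sigma> = 0"
        then have "(delta_min m k P)\<^sup>2 * w \<le> 0"
          using w(2) by (simp add: s_def)
        moreover have "(delta_min m k P)\<^sup>2 * w > 0"
          using w(1,3) False by simp
        ultimately show False
          by simp
      qed
      \<comment> \<open>The factor common to the separation hypothesis and the noise bound; being
        positive, it can be cancelled.\<close>
      define c where "c = K\<^sup>2 * (real k)\<^sup>2 * ?\<alpha> * ?\<sigma>\<^sup>2"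
      have "c > 0"
        using \<open>K > 0\<close> k \<alpha>(1) \<open>?\<sigma> \<noteq> 0\<close> by (simp add: c_def)
      have "(288 / \<epsilon> * w) * c = (288 * K\<^sup>2 / \<epsilon> * (real k)\<^sup>2 * ?\<alpha> * ?\<sigma>\<^sup>2) * w"
        by (simp add: c_def)
      also have "\<dots> \<le> (delta_min m k P)\<^sup>2 * w"
        using sep w(1) by (rule mult_right_mono)
      also have "\<dots> \<le> 144 * real k * (real N * s\<^sup>2)"
        using w(2) by simp
      also have "\<dots> \<le> 144 * real k * ((real k * (?\<alpha> * real ?b)) * (K\<^sup>2 * ?\<sigma>\<^sup>2))"
        using N_le s \<alpha>(1) by (intro mult_left_mono mult_mono) auto
      also have "\<dots> = (144 * real ?b) * c"
        by (simp add: c_def power2_eq_square)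
      finally have "288 / \<epsilon> * w \<le> 144 * real ?b"
        using \<open>c > 0\<close> by (simp only: mult_le_cancel_right_pos)
      then show ?thesis
        using b \<open>\<epsilon> > 0\<close> by (simp add: field_simps)
    qed
    with frob show ?thesis
      by linarith
  qed
  then show "\<exists>E\<in>sets (sample N lab P). measure (sample N lab P) E \<ge> 1 - 2 * \<eta> \<and>
      (\<forall>x\<in>E. \<forall>X. sdp_minimizer k N (dist_mat m N x) X \<longrightarrow> (frobenius_norm (X - X_ref k N lab))\<^sup>2 \<le> \<epsilon>)"
    using E prob by (intro bexI[of _ E]) auto
qed (use \<open>K > 0\<close> in simp_all)

end
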